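(* Let $(X,\triangleleft)$ be a finite quandle. The following conditions are equivalent: (1) $(X,\triangleleft)$ is abelian, i.e. $(a\triangleleft b)\triangleleft c=(a\triangleleft c)\triangleleft b$ for all $a,b,c\in X$; (2) $(X,\triangleleft)$ is $2$-reductive, i.e. $a\triangleleft(b\triangleleft c)=a\triangleleft b$ for all $a,b,c\in X$; (3) $(X,\triangleleft)$ is (isomorphic to) a filtered-permutation quandle. Moreover, two filtered-permutation quandles with $r$ ordered orbits are isomorphic (by an isomorphism preserving the order of the orbits) if and only if they have the same parameters $M^{(1)},\ldots,M^{(r)}$.
   Context: A quandle is a set $X$ with a binary operation $\triangleleft$ such that for all $a,b,c\in X$: $(a\triangleleft b)\triangleleft c=(a\triangleleft c)\triangleleft(b\triangleleft c)$; the right translation $-\triangleleft b$ is a bijection $X\to X$; $a\triangleleft a=a$. Its orbits are the orbits of $X$ with respect to all right translations. Filtered-permutation quandles. Fix an integer $r\ge 2$. A parameter collection is a family of integers $M=(m_{i,j})_{1\le j\le i<r}$ with $m_{i,i}\ge 1$ and $0\le m_{j,i}<m_{i,i}$ for $i<j$. It defines the finite abelian group $G(M)$ generated by pairwise commuting $x_1,\ldots,x_{r-1}$ subject to the relations $x_1^{m_{i,1}}x_2^{m_{i,2}}\cdots x_i^{m_{i,i}}=1$ for $1\le i\le r-1$. Put $x_0:=1$. Given $r$ parameter collections $M^{(1)},\ldots,M^{(r)}$, let $Q(M^{(1)},\ldots,M^{(r)})=G(M^{(1)})\sqcup\cdots\sqcup G(M^{(r)})$, with $x_k^{(i)}$ denoting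 the element $x_k$ of $G(M^{(i)})$, and with the operation $a\triangleleft b=a\,x_k^{(i)}\in G(M^{(i)})$ for $a\in G(M^{(i)})$, $b\in G(M^{(i+k)})$, $0\le k<r$, where $i+k$ is taken modulo $r$. This is an abelian quandle with orbits $G(M^{(1)}),\ldots,G(M^{(r)})$ (ordered by their index); the quandles of this form are called filtered-permutation quandles, and $M^{(1)},\ldots,M^{(r)}$ are their parameters.
   Formalization: The equivalence with condition (3) is stated for finite quandles with at least two elements: since r ≥ 2, a filtered-permutation quandle has at least two elements, so the one-point (and empty) quandle satisfies (1) and (2) but not (3). *)

theory Defs
  imports "HOL-Algebra.Free_Abelian_Groups"
begin

section \<open>Quandles\<close>

locale quandle =
  fixes X :: "'a set" and tri :: "'a \<Rightarrow> 'a \<Rightarrow> 'a"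
  assumes self_distrib:
      "\<lbrakk>a \<in> X; b \<in> X; c \<in> X\<rbrakk> \<Longrightarrow> tri (tri a b) c = tri (tri a c) (tri b c)"
    and bij_right: "b \<in> X \<Longrightarrow> bij_betw (\<lambda>a. tri a b) X X"
    and idem: "a \<in> X \<Longrightarrow> tri a a = a"

definition abelian_quandle :: "'a set \<Rightarrow> ('a \<Rightarrow> 'a \<Rightarrow> 'a) \<Rightarrow> bool" where
  "abelian_quandle X tri \<longleftrightarrow>
     quandle X tri \<and> (\<forall>a\<in>X. \<forall>b\<in>X. \<forall>c\<in>X. tri (tri a b) c = tri (tri a c) b)"

definition two_reductive_quandle :: "'a set \<Rightarrow> ('a \<Rightarrow> 'a \<Rightarrow> 'a) \<Rightarrow> bool" where
  "two_reductive_quandle X tri \<longleftrightarrow>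
     quandle X tri \<and> (\<forall>a\<in>X. \<forall>b\<in>X. \<forall>c\<in>X. tri a (tri b c) = tri a b)"

text \<open>Orbits are the classes of the equivalence relation generated by the right translations,
  i.e. the orbits of the group that these bijections generate.\<close>

definition quandle_orbit :: "'a set \<Rightarrow> ('a \<Rightarrow> 'a \<Rightarrow> 'a) \<Rightarrow> 'a \<Rightarrow> 'a set" where
  "quandle_orbit X tri a =
     (let R = {(x, tri x b) |x b. x \<in> X \<and> b \<in> X} in (R \<union> R\<inverse>)\<^sup>* `` {a})"

definition quandle_iso ::
  "('a \<Rightarrow> 'b) \<Rightarrow> 'a set \<Rightarrow> ('a \<Rightarrow> 'a \<Rightarrow> 'a) \<Rightarrow> 'b set \<Rightarrow> ('b \<Rightarrow> 'b \<Rightarrow> 'b) \<Rightarrow> bool" where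
  "quandle_iso f X tri Y tri' \<longleftrightarrow>
     bij_betw f X Y \<and> (\<forall>a\<in>X. \<forall>b\<in>X. f (tri a b) = tri' (f a) (f b))"


section \<open>Filtered-permutation quandles\<close>

text \<open>A family \<open>(m\<^sub>i\<^sub>,\<^sub>j)\<close> with \<open>1 \<le> j \<le> i < r\<close> is represented by a total function;
  its values outside this index set are irrelevant, so that equality of families is
  agreement on the index set.\<close>

definition parameter_collection :: "nat \<Rightarrow> (nat \<Rightarrow> nat \<Rightarrow> int) \<Rightarrow> bool" where
  "parameter_collection r m \<longleftrightarrow>
     (\<forall>i\<in>{1..<r}. 1 \<le> m i i) \<and>
     (\<forall>i\<in>{1..<r}. \<forall>j\<in>{1..<r}. i < j \<longrightarrow> 0 \<le> m j i \<and> m j i < m i i)"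

definition same_parameters ::
  "nat \<Rightarrow> (nat \<Rightarrow> nat \<Rightarrow> int) \<Rightarrow> (nat \<Rightarrow> nat \<Rightarrow> int) \<Rightarrow> bool" where
  "same_parameters r m m' \<longleftrightarrow> (\<forall>i\<in>{1..<r}. \<forall>j\<in>{1..i}. m i j = m' i j)"

text \<open>The abelian group on commuting generators \<open>x\<^sub>1, \<dots>, x\<^sub>r\<^sub>-\<^sub>1\<close> with the given relations is the
  quotient of the free abelian group on the indices \<open>1, \<dots>, r - 1\<close> by the subgroup generated by
  the relators.  The relator \<open>x\<^sub>1\<^sup>m\<^sup>(\<^sup>i\<^sup>,\<^sup>1\<^sup>) \<cdots> x\<^sub>i\<^sup>m\<^sup>(\<^sup>i\<^sup>,\<^sup>i\<^sup>)\<close> is a formal sum there, since the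
  library writes the elements of a free abelian group additively.\<close>

definition relator :: "(nat \<Rightarrow> nat \<Rightarrow> int) \<Rightarrow> nat \<Rightarrow> (nat \<Rightarrow>\<^sub>0 int)" where
  "relator m i = (\<Sum>j=1..i. frag_cmul (m i j) (frag_of j))"

definition relation_subgroup :: "nat \<Rightarrow> (nat \<Rightarrow> nat \<Rightarrow> int) \<Rightarrow> (nat \<Rightarrow>\<^sub>0 int) set" where
  "relation_subgroup r m = generate (free_Abelian_group {1..<r}) (relator m ` {1..<r})"

definition param_group :: "nat \<Rightarrow> (nat \<Rightarrow> nat \<Rightarrow> int) \<Rightarrow> (nat \<Rightarrow>\<^sub>0 int) set monoid" where
  "param_group r m = free_Abelian_group {1..<r} Mod relation_subgroup r m"

definition param_gen :: "nat \<Rightarrow> (nat \<Rightarrow> nat \<Rightarrow> int) \<Rightarrow> nat \<Rightarrow> (nat \<Rightarrow>\<^sub>0 int) set" where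
  "param_gen r m k =
     (if k = 0 then \<one>\<^bsub>param_group r m\<^esub>
      else relation_subgroup r m #>\<^bsub>free_Abelian_group {1..<r}\<^esub> frag_of k)"

text \<open>The disjoint union consists of the pairs \<open>(i, a)\<close> with \<open>1 \<le> i \<le> r\<close> and \<open>a\<close> in the \<open>i\<close>-th
  group.  In \<open>fp_op\<close>, the element \<open>(j, b)\<close> lies in the group of index \<open>i + k\<close> modulo \<open>r\<close> for
  exactly one \<open>0 \<le> k < r\<close>, namely the residue of \<open>j - i\<close>.\<close>

type_synonym fp_elem = "nat \<times> (nat \<Rightarrow>\<^sub>0 int) set"

definition fp_component :: "nat \<Rightarrow> (nat \<Rightarrow> nat \<Rightarrow> nat \<Rightarrow> int) \<Rightarrow> nat \<Rightarrow> fp_elem set" where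
  "fp_component r M i = {i} \<times> carrier (param_group r (M i))"

definition fp_carrier :: "nat \<Rightarrow> (nat \<Rightarrow> nat \<Rightarrow> nat \<Rightarrow> int) \<Rightarrow> fp_elem set" where
  "fp_carrier r M = (\<Union>i\<in>{1..r}. fp_component r M i)"

definition fp_op ::
  "nat \<Rightarrow> (nat \<Rightarrow> nat \<Rightarrow> nat \<Rightarrow> int) \<Rightarrow> fp_elem \<Rightarrow> fp_elem \<Rightarrow> fp_elem" where
  "fp_op r M = (\<lambda>(i, a) (j, b).
     (i, a \<otimes>\<^bsub>param_group r (M i)\<^esub> param_gen r (M i) (nat ((int j - int i) mod int r))))"

text \<open>Since \<open>r \<ge> 2\<close>, a filtered-permutation quandle has at least two elements.  The one-point
  quandle, which is abelian and 2-reductive, would be the excluded case \<open>r = 1\<close>.\<close>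

definition fp_parameters :: "nat \<Rightarrow> (nat \<Rightarrow> nat \<Rightarrow> nat \<Rightarrow> int) \<Rightarrow> bool" where
  "fp_parameters r M \<longleftrightarrow> r \<ge> 2 \<and> (\<forall>i\<in>{1..r}. parameter_collection r (M i))"

definition is_filtered_permutation_quandle :: "'a set \<Rightarrow> ('a \<Rightarrow> 'a \<Rightarrow> 'a) \<Rightarrow> bool" where
  "is_filtered_permutation_quandle X tri \<longleftrightarrow>
     (\<exists>r M f. fp_parameters r M \<and> quandle_iso f X tri (fp_carrier r M) (fp_op r M))"

text \<open>The orbits of the quandle are its components \<open>fp_component r M 1, \<dots>, fp_component r M r\<close>
  (lemma \<open>fp_component_is_orbit\<close> below), so an isomorphism preserves the order of the orbits
  iff it maps the \<open>i\<close>-th component onto the \<open>i\<close>-th component for every \<open>i\<close>.\<close>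

definition orbit_order_iso ::
  "nat \<Rightarrow> (nat \<Rightarrow> nat \<Rightarrow> nat \<Rightarrow> int) \<Rightarrow> (nat \<Rightarrow> nat \<Rightarrow> nat \<Rightarrow> int) \<Rightarrow> (fp_elem \<Rightarrow> fp_elem) \<Rightarrow> bool" where
  "orbit_order_iso r M M' f \<longleftrightarrow>
     quandle_iso f (fp_carrier r M) (fp_op r M) (fp_carrier r M') (fp_op r M') \<and>
     (\<forall>i\<in>{1..r}. f ` fp_component r M i = fp_component r M' i)"


lemma relation_subgroup_normal: "relation_subgroup r m \<lhd> free_Abelian_group {1..<r}"
proof -
  interpret comm_group "free_Abelian_group {1..<r}"
    by (rule abelian_free_Abelian_group)
  have "relator m ` {1..<r} \<subseteq> carrier (free_Abelian_group {1..<r})"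
  proof (rule image_subsetI)
    fix i assume i: "i \<in> {1..<r}"
    show "relator m i \<in> carrier (free_Abelian_group {1..<r})"
      unfolding relator_def
    proof (rule sum_closed_free_Abelian_group)
      fix j assume "j \<in> {1..i}"
      then show "frag_cmul (m i j) (frag_of j) \<in> carrier (free_Abelian_group {1..<r})"
        using i keys_cmul[of "m i j" "frag_of j"] by auto
    qed
  qed
  then show ?thesis
    unfolding relation_subgroup_def
    using generate_is_subgroup subgroup_imp_normal by blast
qed

lemma comm_group_param_group: "comm_group (param_group r m)"
  unfolding param_group_def
  by (rule comm_group.abelian_FactGroup[OF abelian_free_Abelian_group])
    (use relation_subgroup_normal normal_imp_subgroup in blast)

lemma param_gen_closed:
  assumes "k < r" shows "param_gen r m k \<in> carrier (param_group r m)"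
proof -
  interpret comm_group "param_group r m" by (rule comm_group_param_group)
  show ?thesis
    using assms one_closed
    by (auto simp: param_gen_def param_group_def carrier_FactGroup)
qed

lemma param_gen_mod_closed:
  "r > 0 \<Longrightarrow> param_gen r m (nat (x mod int r)) \<in> carrier (param_group r m)"
  by (intro param_gen_closed) (simp add: nat_less_iff)


lemma quandle_fp:
  assumes "r \<ge> 1" shows "quandle (fp_carrier r M) (fp_op r M)"
proof
  fix a b c assume *: "a \<in> fp_carrier r M" "b \<in> fp_carrier r M" "c \<in> fp_carrier r M"
  obtain i a' j b' k c' where abc: "a = (i,a')" "b = (j,b')" "c = (k,c')"
    by (metis surj_pair)
  interpret comm_group "param_group r (M i)" by (rule comm_group_param_group)
  have "a' \<in> carrier (param_group r (M i))"
    using * abc by (simp add: fp_carrier_def fp_component_def)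
  then show "fp_op r M (fp_op r M a b) c = fp_op r M (fp_op r M a c) (fp_op r M b c)"
    using param_gen_mod_closed[of r "M i"] assms
    by (simp add: abc fp_op_def m_ac)
next
  fix b assume *: "b \<in> fp_carrier r M"
  obtain j b' where b: "b = (j,b')" by (metis surj_pair)
  define g where "g i = param_gen r (M i) (nat ((int j - int i) mod int r))" for i
  have g: "g i \<in> carrier (param_group r (M i))" for i
    using param_gen_mod_closed[of r "M i"] assms by (simp add: g_def)
  have G: "Group.group (param_group r (M i))" for i
    using comm_group_param_group comm_group.axioms(2) by blast
  have op: "fp_op r M (i, a) b = (i, a \<otimes>\<^bsub>param_group r (M i)\<^esub> g i)" for i a
    by (simp add: fp_op_def g_def b)
  have mem: "(i, a) \<in> fp_carrier r M \<longleftrightarrow> i \<in> {1..r} \<and> a \<in> carrier (param_group r (M i))" for i a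
    by (auto simp: fp_carrier_def fp_component_def)
  show "bij_betw (\<lambda>a. fp_op r M a b) (fp_carrier r M) (fp_carrier r M)"
    unfolding bij_betw_def
  proof (intro conjI inj_onI equalityI subsetI)
    fix x y assume xy: "x \<in> fp_carrier r M" "y \<in> fp_carrier r M" "fp_op r M x b = fp_op r M y b"
    obtain i a j c where p: "x = (i, a)" "y = (j, c)" by (metis surj_pair)
    then have ij: "j = i" using xy(3) by (simp add: op)
    interpret group "param_group r (M i)" by (rule G)
    have "a = c" using xy g[of i] by (simp add: p ij op mem)
    then show "x = y" by (simp add: p ij)
  next
    fix y assume "y \<in> (\<lambda>a. fp_op r M a b) ` fp_carrier r M"
    then obtain i a where y: "y = fp_op r M (i, a) b" "(i, a) \<in> fp_carrier r M" by auto
    interpret group "param_group r (M i)" by (rule G)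
    show "y \<in> fp_carrier r M" using y g[of i] by (simp add: op mem)
  next
    fix y assume y: "y \<in> fp_carrier r M"
    obtain i a where ya: "y = (i, a)" by (metis surj_pair)
    interpret group "param_group r (M i)" by (rule G)
    have a: "a \<in> carrier (param_group r (M i))" using y ya mem by blast
    let ?x = "(i, a \<otimes>\<^bsub>param_group r (M i)\<^esub> inv\<^bsub>param_group r (M i)\<^esub> g i)"
    have "fp_op r M ?x b = y"
      using a g[of i] by (simp add: op ya m_assoc)
    moreover have "?x \<in> fp_carrier r M" using y a g[of i] ya by (simp add: mem)
    ultimately show "y \<in> (\<lambda>a. fp_op r M a b) ` fp_carrier r M" by (metis image_eqI)
  qed
next
  fix a assume *: "a \<in> fp_carrier r M"
  obtain i a' where a: "a = (i,a')" by (metis surj_pair)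
  interpret comm_group "param_group r (M i)" by (rule comm_group_param_group)
  have "a' \<in> carrier (param_group r (M i))"
    using * a by (simp add: fp_carrier_def fp_component_def)
  then show "fp_op r M a a = a"
    by (simp add: a fp_op_def param_gen_def)
qed

lemma fp_component_is_orbit:
  assumes r: "r \<ge> 1" and i: "i \<in> {1..r}" and p: "p \<in> fp_component r M i"
  shows "quandle_orbit (fp_carrier r M) (fp_op r M) p = fp_component r M i"
proof -
  let ?F = "free_Abelian_group {1..<r}" and ?N = "relation_subgroup r (M i)" and ?G = "param_group r (M i)"
  define R where "R = {(x, fp_op r M x b) |x b. x \<in> fp_carrier r M \<and> b \<in> fp_carrier r M}"
  let ?S = "(R \<union> R\<inverse>)\<^sup>*"
  interpret N: normal ?N ?F by (rule relation_subgroup_normal)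
  interpret Q: quandle "fp_carrier r M" "fp_op r M" by (rule quandle_fp[OF r])
  have fstR: "fst x = fst y" if "(x, y) \<in> R" for x y
    using that by (auto simp: R_def fp_op_def split: prod.splits)
  have inR: "x \<in> fp_carrier r M \<and> y \<in> fp_carrier r M" if "(x, y) \<in> R" for x y
    using that Q.bij_right unfolding R_def bij_betw_def by auto
  have comp: "x \<in> fp_component r M i \<longleftrightarrow> x \<in> fp_carrier r M \<and> fst x = i" for x
    using i by (auto simp: fp_carrier_def fp_component_def)
  have sub: "y \<in> fp_component r M i" if "(p, y) \<in> ?S" for y
    using that p by (induction) (auto simp: comp dest: fstR inR)
  have symS: "(x, y) \<in> ?S \<Longrightarrow> (y, x) \<in> ?S" for x y
    by (metis sym_rtrancl sym_Un_converse symD)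
  have trS: "(x, y) \<in> ?S \<Longrightarrow> (y, z) \<in> ?S \<Longrightarrow> (x, z) \<in> ?S" for x y z
    by (rule rtrancl_trans)
  define c where "c w = (i, ?N #>\<^bsub>?F\<^esub> w)" for w
  have cmem: "fp_component r M i = c ` carrier ?F"
    by (auto simp: fp_component_def param_group_def carrier_FactGroup c_def)
  have key: "\<forall>w. Poly_Mapping.keys w \<subseteq> {1..<r} \<longrightarrow> (c w, c (w + z)) \<in> ?S"
    (is "?P z") if "Poly_Mapping.keys z \<subseteq> {1..<r}" for z
  proof (rule free_Abelian_group_induct[OF that, where P = ?P])
    show "?P 0" by simp
  next
    fix x y :: "nat \<Rightarrow>\<^sub>0 int"
    assume 2: "Poly_Mapping.keys x \<subseteq> {1..<r}" "Poly_Mapping.keys y \<subseteq> {1..<r}" "?P x" "?P y"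
    show "?P (x - y)"
    proof (intro allI impI)
      fix w :: "nat \<Rightarrow>\<^sub>0 int" assume w: "Poly_Mapping.keys w \<subseteq> {1..<r}"
      then have "Poly_Mapping.keys (w + x - y) \<subseteq> {1..<r}"
        using 2(1,2) keys_diff[of "w + x" y] Poly_Mapping.keys_add[of w x] by blast
      with 2(4) have "(c (w + x - y), c (w + x - y + y)) \<in> ?S" by blast
      then have "(c (w + (x - y)), c (w + x)) \<in> ?S" by (simp only: add_diff_eq diff_add_cancel)
      moreover have "(c w, c (w + x)) \<in> ?S" using w 2(3) by blast
      ultimately show "(c w, c (w + (x - y))) \<in> ?S" using symS trS by blast
    qed
  next
    fix k assume "k \<in> {1..<r}"
    then have k: "1 \<le> k" "k < r" by auto
    define j where "j = (if i + k \<le> r then i + k else i + k - r)"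
    have j: "j \<in> {1..r}" using k i by (auto simp: j_def)
    have "int j - int i = int k \<or> int j - int i = int k - int r"
      using i k by (auto simp: j_def)
    then have jk: "(int j - int i) mod int r = int k"
    proof
      assume "int j - int i = int k - int r"
      then show ?thesis using k by (simp only: minus_mod_self2) simp
    qed (use k in simp)
    interpret H: comm_group "param_group r (M j)" by (rule comm_group_param_group)
    define b where "b = (j, \<one>\<^bsub>param_group r (M j)\<^esub>)"
    have b: "b \<in> fp_carrier r M"
      using j H.one_closed by (auto simp: b_def fp_carrier_def fp_component_def simp del: One_nat_def)
    show "?P (frag_of k)"
    proof (intro allI impI)
      fix w :: "nat \<Rightarrow>\<^sub>0 int" assume w: "Poly_Mapping.keys w \<subseteq> {1..<r}"
      then have cw: "c w \<in> fp_carrier r M"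
        using cmem comp by (metis carrier_free_Abelian_group_iff image_eqI)
      have "(?N #>\<^bsub>?F\<^esub> w) <#>\<^bsub>?F\<^esub> (?N #>\<^bsub>?F\<^esub> frag_of k) = ?N #>\<^bsub>?F\<^esub> (w \<otimes>\<^bsub>?F\<^esub> frag_of k)"
        by (rule N.rcos_sum) (use w k in auto)
      then have opb: "fp_op r M (c w) b = c (w + frag_of k)"
        using k jk by (simp add: fp_op_def param_gen_def c_def b_def param_group_def)
      have "(c w, fp_op r M (c w) b) \<in> R" using cw b unfolding R_def by blast
      then have "(c w, c (w + frag_of k)) \<in> R" by (simp only: opb)
      then show "(c w, c (w + frag_of k)) \<in> ?S" by blast
    qed
  qed
  have "y \<in> ?S `` {p}" if y: "y \<in> fp_component r M i" for y
  proof -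
    obtain w v where "p = c w" "y = c v" "Poly_Mapping.keys w \<subseteq> {1..<r}" "Poly_Mapping.keys v \<subseteq> {1..<r}"
      using p y cmem by auto
    moreover from this have "Poly_Mapping.keys (v - w) \<subseteq> {1..<r}"
      using keys_diff[of v w] by blast
    moreover have "w + (v - w) = v" by simp
    ultimately show ?thesis using key[of "v - w"] by (metis Image_singleton_iff)
  qed
  with sub show ?thesis unfolding quandle_orbit_def R_def[symmetric] Let_def by blast
qed

end

theory Submission
  imports Defs "HOL-Algebra.Bij"
begin

text \<open>In a 2-reductive quandle \<open>a \<triangleleft> b\<close> depends only on \<open>a\<close> and the orbit of \<open>b\<close>, elements act trivially on
  their own orbit, and all translations commute.  With \<open>r\<close> orbits, each orbit is therefore a transitive
  \<open>\<int>\<^sup>r\<^sup>-\<^sup>1\<close>-set, that is, \<open>\<int>\<^sup>r\<^sup>-\<^sup>1\<close> modulo a subgroup of finite index.  Parameter collections are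
  exactly the Hermite normal forms of such subgroups, which exist and are unique.  An isomorphism that
  preserves the order of the orbits is equivariant on each orbit, hence preserves these subgroups.\<close>

section \<open>Hermite normal forms\<close>

text \<open>Self-distributivity turns 2-reductivity into commutation of right translations;
  idempotence, together with dependence on the orbit alone, makes an orbit act trivially on itself.
  Orbit \<open>i\<close> is thus moved only by the \<open>r - 1\<close> other orbits, numbered
  cyclically from \<open>i\<close>: this is the origin of the \<open>r - 1\<close> generators and of
  \<open>x_0 = 1\<close>. Coordinates on different orbits need not be compatible, because the
  operation moves its left argument and reads only the orbit of its right one; each orbit is
  parametrized on its own. Finiteness enters the normal form by pigeonhole: some positive multiple
  of every generator fixes the base point, so every diagonal entry can be chosen positive. An
  isomorphism need not send the identity of a component group to the identity. It still preserves
  the subgroup, because the acting group is abelian and all points of an orbit have the same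
  stabilizer.\<close>

lemma subgroup_free_Abelian_groupD:
  assumes "subgroup N (free_Abelian_group S)"
  shows "0 \<in> N"
    and "x \<in> N \<Longrightarrow> y \<in> N \<Longrightarrow> x + y \<in> N"
    and "x \<in> N \<Longrightarrow> y \<in> N \<Longrightarrow> x - y \<in> N"
    and "x \<in> N \<Longrightarrow> Poly_Mapping.keys x \<subseteq> S"
    and "x \<in> N \<Longrightarrow> frag_cmul c x \<in> N"
proof -
  show z: "0 \<in> N" using subgroup.one_closed[OF assms] by simp
  show "x \<in> N \<Longrightarrow> y \<in> N \<Longrightarrow> x + y \<in> N" for x y
    using subgroup.m_closed[OF assms, of x y] by simp
  show k: "x \<in> N \<Longrightarrow> Poly_Mapping.keys x \<subseteq> S" for x
    using subgroup.mem_carrier[OF assms, of x] by simp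
  show d: "x \<in> N \<Longrightarrow> y \<in> N \<Longrightarrow> x - y \<in> N" for x y
    using subgroup.m_closed[OF assms, of x "- y"] subgroup.m_inv_closed[OF assms, of y] k[of y]
    by simp
  show "frag_cmul c x \<in> N" if "x \<in> N" for x
    by (rule frag_closure_minus_cmul[where P = "\<lambda>y. y \<in> N"]) (use that z d in auto)
qed

lemma parameter_collectionD:
  assumes "parameter_collection r m" and "i \<in> {1..<r}"
  shows "1 \<le> m i i" and "j \<in> {1..<i} \<Longrightarrow> 0 \<le> m i j" and "j \<in> {1..<i} \<Longrightarrow> m i j < m j j"
  using assms by (auto simp: parameter_collection_def)

section \<open>Triangular rows and uniqueness of the normal form\<close>

lemma lookup_relator:
  "Poly_Mapping.lookup (relator m i) j = (if j \<in> {1..i} then m i j else 0)"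
  by (simp add: relator_def lookup_sum if_distrib cong: if_cong)

lemma keys_relator: "Poly_Mapping.keys (relator m i) \<subseteq> {1..i}"
  by (auto simp: in_keys_iff lookup_relator split: if_splits)

lemma subgroup_relation_subgroup: "subgroup (relation_subgroup r m) (free_Abelian_group {1..<r})"
  using relation_subgroup_normal normal_imp_subgroup by blast

lemma relator_in_relation_subgroup: "i \<in> {1..<r} \<Longrightarrow> relator m i \<in> relation_subgroup r m"
  unfolding relation_subgroup_def by (rule generate.incl) blast

text \<open>Integer combinations contain the relators and are closed under sums and negation, so
  commutativity collapses a product built by \<open>generate\<close> to one coefficient per row. The
  leading-entry argument works with these coefficients.\<close>

lemma relation_subgroup_combination:
  assumes "v \<in> relation_subgroup r m"
  obtains a where "v = (\<Sum>k\<in>{1..<r}. frag_cmul (a k) (relator m k))"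
proof -
  define L where "L = {v. \<exists>a. v = (\<Sum>k\<in>{1..<r}. frag_cmul (a k) (relator m k))}"
  have single: "relator m i = (\<Sum>k\<in>{1..<r}. frag_cmul (if k = i then 1 else 0) (relator m k))"
    if "i \<in> {1..<r}" for i
    using that by (simp add: if_distrib if_distribR cong: if_cong)
  have "v \<in> L"
    using assms unfolding relation_subgroup_def
  proof (induction rule: generate.induct)
    case one
    show ?case by (auto simp: L_def intro!: exI[of _ "\<lambda>_. 0"])
  next
    case (incl h)
    then show ?case using single unfolding L_def by auto
  next
    case (inv h)
    then obtain i where i: "i \<in> {1..<r}" "h = relator m i" by blast
    have "Poly_Mapping.keys h \<subseteq> {1..<r}" using i keys_relator[of m i] by auto
    then have "inv\<^bsub>free_Abelian_group {1..<r}\<^esub> h = - h" by simp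
    also have "\<dots> = (\<Sum>k\<in>{1..<r}. frag_cmul (- (if k = i then 1 else 0)) (relator m k))"
      by (subst i(2), subst single[OF i(1)]) (simp add: sum_negf flip: minus_frag_cmul)
    finally show ?case unfolding L_def
      by (intro CollectI exI[of _ "\<lambda>k. - (if k = i then 1 else 0)"])
  next
    case (eng h1 h2)
    then obtain a b where "h1 = (\<Sum>k\<in>{1..<r}. frag_cmul (a k) (relator m k))"
      "h2 = (\<Sum>k\<in>{1..<r}. frag_cmul (b k) (relator m k))" unfolding L_def by blast
    then have "h1 + h2 = (\<Sum>k\<in>{1..<r}. frag_cmul (a k + b k) (relator m k))"
      by (simp add: frag_cmul_distrib sum.distrib)
    then show ?case unfolding L_def by auto
  qed
  then show ?thesis using that unfolding L_def by blast
qed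

text \<open>The rows are triangular: the last row \<open>t\<close> with a nonzero coefficient alone
  determines the entries from \<open>t\<close> on, so \<open>t\<close> is also the last nonzero
  position of \<open>v\<close>, with entry \<open>a t * m t t\<close>.\<close>

lemma relation_subgroup_leading_dvd:
  assumes m: "parameter_collection r m" and v: "v \<in> relation_subgroup r m"
    and i: "Poly_Mapping.lookup v i \<noteq> 0" and above: "\<And>j. i < j \<Longrightarrow> Poly_Mapping.lookup v j = 0"
  shows "m i i dvd Poly_Mapping.lookup v i"
proof -
  obtain a where a: "v = (\<Sum>k\<in>{1..<r}. frag_cmul (a k) (relator m k))"
    using relation_subgroup_combination[OF v] .
  define A where "A = {k \<in> {1..<r}. a k \<noteq> 0}"
  have A: "finite A" "A \<noteq> {}"
    using i by (auto simp: A_def a lookup_sum intro!: sum.neutral)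
  define t where "t = Max A"
  have t: "t \<in> {1..<r}" "a t \<noteq> 0" "\<And>k. k \<in> {1..<r} \<Longrightarrow> t < k \<Longrightarrow> a k = 0"
    using Max_in[OF A] Max_ge[OF A(1)] unfolding t_def[symmetric]
    by (fastforce simp: A_def)+
  \<comment> \<open>Earlier rows vanish from position \<open>t\<close> on and later rows have
    coefficient zero, so only row \<open>t\<close> contributes.\<close>
  have lv: "Poly_Mapping.lookup v j
      = (\<Sum>k\<in>{1..<r}. if k = t then a t * (if j \<in> {1..t} then m t j else 0) else 0)"
    if "t \<le> j" for j
    unfolding a lookup_sum
    by (rule sum.cong) (use that t(3) in \<open>auto simp: lookup_relator nat_neq_iff\<close>)
  have top: "Poly_Mapping.lookup v t = a t * m t t" using lv[of t] t(1) by simp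
  have "Poly_Mapping.lookup v j = 0" if "t < j" for j using lv[of j] that t(1) by simp
  then have "i \<le> t" using i by (metis not_less)
  moreover have "Poly_Mapping.lookup v t \<noteq> 0"
    using top t(2) parameter_collectionD(1)[OF m t(1)] by simp
  then have "t \<le> i" using above not_less by blast
  ultimately show ?thesis using top by simp
qed

text \<open>The last nonzero entry of a nonzero element is a multiple of the diagonal entry there,
  hence not smaller than it in absolute value.\<close>

lemma relation_subgroup_small_eq_0:
  assumes m: "parameter_collection r m" and v: "v \<in> relation_subgroup r m"
    and small: "\<And>j. j \<in> {1..<r} \<Longrightarrow> \<bar>Poly_Mapping.lookup v j\<bar> < m j j"
  shows "v = 0"
proof (rule ccontr)
  assume "v \<noteq> 0"
  then have ne: "Poly_Mapping.keys v \<noteq> {}" by simp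
  define i where "i = Max (Poly_Mapping.keys v)"
  have i: "i \<in> Poly_Mapping.keys v" unfolding i_def by (rule Max_in) (use ne in simp_all)
  have above: "Poly_Mapping.lookup v j = 0" if "i < j" for j
    using that Max_ge[of "Poly_Mapping.keys v" j] unfolding i_def[symmetric]
    by (auto simp: in_keys_iff)
  have ir: "i \<in> {1..<r}" using subgroup_free_Abelian_groupD(4)[OF subgroup_relation_subgroup v] i by blast
  have "m i i dvd Poly_Mapping.lookup v i"
    using relation_subgroup_leading_dvd[OF m v _ above] i by (simp add: in_keys_iff)
  then show False
    using small[OF ir] i dvd_imp_le_int[of "Poly_Mapping.lookup v i" "m i i"] by (simp add: in_keys_iff)
qed

lemma relation_subgroup_diag_dvd:
  assumes m: "parameter_collection r m" and m': "parameter_collection r m'"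
    and eq: "relation_subgroup r m = relation_subgroup r m'" and i: "i \<in> {1..<r}"
  shows "m i i dvd m' i i"
proof -
  have "m' i i \<noteq> 0" using parameter_collectionD(1)[OF m' i] by simp
  then have "m i i dvd Poly_Mapping.lookup (relator m' i) i"
    by (intro relation_subgroup_leading_dvd[OF m])
      (use i relator_in_relation_subgroup eq in \<open>auto simp: lookup_relator\<close>)
  then show ?thesis using i by (simp add: lookup_relator)
qed

text \<open>Mutual divisibility fixes the diagonal; then the difference of two corresponding rows
  lies in the subgroup, and each of its entries is smaller than the diagonal entry of that
  column.\<close>

lemma relation_subgroup_inj:
  assumes m: "parameter_collection r m" and m': "parameter_collection r m'"
    and eq: "relation_subgroup r m = relation_subgroup r m'"
  shows "same_parameters r m m'"
proof -
  have diag: "m i i = m' i i" if i: "i \<in> {1..<r}" for i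
  proof (rule zdvd_antisym_nonneg)
    show "0 \<le> m i i" "0 \<le> m' i i"
      using parameter_collectionD(1)[OF m i] parameter_collectionD(1)[OF m' i] by simp_all
    show "m i i dvd m' i i" by (rule relation_subgroup_diag_dvd[OF m m' eq i])
    show "m' i i dvd m i i" by (rule relation_subgroup_diag_dvd[OF m' m eq[symmetric] i])
  qed
  have rel_eq: "relator m i - relator m' i = 0" if i: "i \<in> {1..<r}" for i
  proof (rule relation_subgroup_small_eq_0[OF m])
    show "relator m i - relator m' i \<in> relation_subgroup r m"
      using relator_in_relation_subgroup[OF i, of m] relator_in_relation_subgroup[OF i, of m']
      unfolding eq by (rule subgroup_free_Abelian_groupD(3)[OF subgroup_relation_subgroup])
  next
    fix j assume j: "j \<in> {1..<r}"
    show "\<bar>Poly_Mapping.lookup (relator m i - relator m' i) j\<bar> < m j j"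
    proof (cases "j < i")
      case True
      then have "0 \<le> m i j" "m i j < m j j" "0 \<le> m' i j" "m' i j < m j j"
        using parameter_collectionD(2,3)[OF m i, of j] parameter_collectionD(2,3)[OF m' i, of j] j diag[OF j]
        by simp_all
      then show ?thesis using True j by (simp add: lookup_minus lookup_relator)
    next
      \<comment> \<open>In column \<open>i\<close> the equal diagonal entries cancel; beyond it both
        rows vanish.\<close>
      case False
      have "1 \<le> m j j" by (rule parameter_collectionD(1)[OF m j])
      then show ?thesis using False diag[OF i] by (cases "i = j") (auto simp: lookup_minus lookup_relator)
    qed
  qed
  have "m i j = m' i j" if "i \<in> {1..<r}" "j \<in> {1..i}" for i j
    using arg_cong[OF rel_eq[OF that(1)], of "\<lambda>v. Poly_Mapping.lookup v j"] that(2)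
    by (simp add: lookup_minus lookup_relator)
  then show ?thesis unfolding same_parameters_def by blast
qed

lemma relation_subgroup_cong:
  assumes "same_parameters r m m'"
  shows "relation_subgroup r m = relation_subgroup r m'"
proof -
  have "relator m i = relator m' i" if "i \<in> {1..<r}" for i
    using assms that by (intro poly_mapping_eqI) (auto simp: lookup_relator same_parameters_def)
  then show ?thesis by (simp add: relation_subgroup_def)
qed

text \<open>Row \<open>i\<close> of the Hermite normal form is an element of \<open>N\<close> supported on \<open>{1..i}\<close> whose \<open>i\<close>-th
  entry is positive and minimal, reduced modulo the rows above it.\<close>

lemma ex_parameter_collection:
  assumes N: "subgroup N (free_Abelian_group {1..<r})"
    and fin: "\<And>k. k \<in> {1..<r} \<Longrightarrow> \<exists>n>0. frag_cmul n (frag_of k) \<in> N"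
  obtains m where "parameter_collection r m" "relation_subgroup r m = N"
proof -
  note N_simps = subgroup_free_Abelian_groupD[OF N]
  define L where "L i = {v \<in> N. Poly_Mapping.keys v \<subseteq> {1..i}}" for i
  have L: "v \<in> L i \<longleftrightarrow> v \<in> N \<and> (\<forall>j. j \<notin> {1..i} \<longrightarrow> Poly_Mapping.lookup v j = 0)" for v i
    unfolding L_def by (auto simp: in_keys_iff)
  have "\<exists>w\<in>L i. 0 < Poly_Mapping.lookup w i \<and>
      (\<forall>v\<in>L i. Poly_Mapping.lookup w i dvd Poly_Mapping.lookup v i)" if i: "i \<in> {1..<r}" for i
  proof -
    let ?P = "\<lambda>w. w \<in> L i \<and> 0 < Poly_Mapping.lookup w i"
    \<comment> \<open>\<open>fin\<close> supplies a candidate, so a least positive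
      \<open>i\<close>-th entry exists.\<close>
    obtain n where "n > 0" "frag_cmul n (frag_of i) \<in> N" using fin[OF i] by blast
    then have "?P (frag_cmul n (frag_of i))" using i by (auto simp: L)
    then obtain w where w: "?P w"
        "\<And>u. ?P u \<Longrightarrow> nat (Poly_Mapping.lookup w i) \<le> nat (Poly_Mapping.lookup u i)"
      using ex_has_least_nat[of ?P _ "\<lambda>w. nat (Poly_Mapping.lookup w i)"] by metis
    have "Poly_Mapping.lookup w i dvd Poly_Mapping.lookup v i" if v: "v \<in> L i" for v
    proof (rule ccontr)
      let ?d = "Poly_Mapping.lookup w i"
      assume nd: "\<not> ?d dvd Poly_Mapping.lookup v i"
      \<comment> \<open>Remainder of a Euclidean division: it stays in \<open>L i\<close>, and its
        \<open>i\<close>-th entry would be positive and below the minimum.\<close>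
      define u where "u = v - frag_cmul (Poly_Mapping.lookup v i div ?d) w"
      have u: "Poly_Mapping.lookup u i = Poly_Mapping.lookup v i mod ?d"
        by (simp add: u_def lookup_minus minus_div_mult_eq_mod)
      have "u \<in> L i" using v w(1) N_simps unfolding L u_def by (simp add: lookup_minus)
      moreover have "0 < Poly_Mapping.lookup u i" "Poly_Mapping.lookup u i < ?d"
        using w(1) nd pos_mod_sign[of ?d "Poly_Mapping.lookup v i"]
          pos_mod_bound[of ?d "Poly_Mapping.lookup v i"]
        by (auto simp: u dvd_eq_mod_eq_0 order_less_le)
      ultimately show False using w(2)[of u] by simp
    qed
    then show ?thesis using w(1) by blast
  qed
  then obtain w where w: "\<And>i. i \<in> {1..<r} \<Longrightarrow> w i \<in> L i"
      "\<And>i. i \<in> {1..<r} \<Longrightarrow> 0 < Poly_Mapping.lookup (w i) i"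
      "\<And>i v. i \<in> {1..<r} \<Longrightarrow> v \<in> L i \<Longrightarrow> Poly_Mapping.lookup (w i) i dvd Poly_Mapping.lookup v i"
    by metis
  define d where "d i = Poly_Mapping.lookup (w i) i" for i
  \<comment> \<open>Reduction runs from the highest position down: a multiple of \<open>w i\<close>
    changes only positions up to \<open>i\<close>, so entries reduced earlier are not
    disturbed.\<close>
  have reduce: "\<exists>u\<in>L i. \<forall>j\<in>{1..i}. 0 \<le> Poly_Mapping.lookup (v - u) j \<and> Poly_Mapping.lookup (v - u) j < d j"
    if "\<forall>j. j \<notin> {1..i} \<longrightarrow> Poly_Mapping.lookup v j = 0" "i < r" for v i
    using that
  proof (induction i arbitrary: v)
    case 0
    then show ?case using N_simps(1) by (auto simp: L intro!: bexI[of _ 0])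
  next
    case (Suc i)
    let ?i = "Suc i"
    have i: "?i \<in> {1..<r}" using Suc.prems(2) by simp
    define z where "z = frag_cmul (Poly_Mapping.lookup v ?i div d ?i) (w ?i)"
    \<comment> \<open>\<open>e\<close> sets the finished entry at \<open>?i\<close> aside so that
      the induction hypothesis applies. It need not lie in \<open>N\<close> and is not part of the
      element \<open>z + u\<close> finally subtracted.\<close>
    define e where "e = frag_cmul (Poly_Mapping.lookup v ?i mod d ?i) (frag_of ?i)"
    have z: "z \<in> L ?i" using w(1)[OF i] N_simps unfolding L z_def by simp
    have zi: "Poly_Mapping.lookup (v - z) ?i = Poly_Mapping.lookup v ?i mod d ?i"
      by (simp add: z_def d_def lookup_minus minus_div_mult_eq_mod)
    have "\<forall>j. j \<notin> {1..i} \<longrightarrow> Poly_Mapping.lookup (v - z - e) j = 0"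
    proof (intro allI impI)
      fix j assume j: "j \<notin> {1..i}"
      show "Poly_Mapping.lookup (v - z - e) j = 0"
      proof (cases "j = ?i")
        case True
        then show ?thesis using zi by (simp add: e_def lookup_minus)
      next
        case False
        then have "j \<notin> {1..?i}" using j by auto
        then show ?thesis using z Suc.prems(1) False by (auto simp: L e_def lookup_minus)
      qed
    qed
    then obtain u where u: "u \<in> L i"
        "\<And>j. j \<in> {1..i} \<Longrightarrow> 0 \<le> Poly_Mapping.lookup (v - z - e - u) j \<and> Poly_Mapping.lookup (v - z - e - u) j < d j"
      using Suc.IH[of "v - z - e"] Suc.prems(2) by auto
    have "u \<in> L ?i" using u(1) by (auto simp: L)
    then have "z + u \<in> L ?i" using z N_simps unfolding L by (simp add: lookup_add)
    moreover have "0 \<le> Poly_Mapping.lookup (v - (z + u)) j \<and> Poly_Mapping.lookup (v - (z + u)) j < d j"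
      if "j \<in> {1..?i}" for j
    proof (cases "j = ?i")
      case True
      have "Poly_Mapping.lookup (v - (z + u)) ?i = Poly_Mapping.lookup v ?i mod d ?i"
        using zi u(1) by (simp add: L lookup_minus lookup_add)
      then show ?thesis using True w(2)[OF i] by (simp add: d_def)
    next
      case False
      then show ?thesis using u(2)[of j] that by (simp add: e_def lookup_minus lookup_add algebra_simps)
    qed
    ultimately show ?case by blast
  qed
  have "\<exists>p\<in>L i. Poly_Mapping.lookup p i = d i \<and>
      (\<forall>j\<in>{1..<i}. 0 \<le> Poly_Mapping.lookup p j \<and> Poly_Mapping.lookup p j < d j)" if i: "i \<in> {1..<r}" for i
  proof -
    \<comment> \<open>The diagonal entry is removed before reducing, since reducing it modulo itself
      would turn it into \<open>0\<close>.\<close>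
    define v where "v = w i - frag_cmul (d i) (frag_of i)"
    have wi: "w i \<in> L i" by (rule w(1)[OF i])
    have "\<forall>j. j \<notin> {1..i - 1} \<longrightarrow> Poly_Mapping.lookup v j = 0"
    proof (intro allI impI)
      fix j assume "j \<notin> {1..i - 1}"
      then have "j = i \<or> j \<notin> {1..i}" by auto
      then show "Poly_Mapping.lookup v j = 0"
        using wi i by (auto simp: L v_def d_def lookup_minus)
    qed
    then obtain u where u: "u \<in> L (i - 1)"
        "\<And>j. j \<in> {1..i - 1} \<Longrightarrow> 0 \<le> Poly_Mapping.lookup (v - u) j \<and> Poly_Mapping.lookup (v - u) j < d j"
      using reduce[of "i - 1" v] i by force
    have ui: "Poly_Mapping.lookup u i = 0" using u(1) i by (auto simp: L)
    show ?thesis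
    proof (intro bexI[of _ "w i - u"] conjI ballI)
      show "w i - u \<in> L i" using wi u(1) N_simps unfolding L by (auto simp: lookup_minus)
      show "Poly_Mapping.lookup (w i - u) i = d i" using ui by (simp add: d_def lookup_minus)
      fix j assume j: "j \<in> {1..<i}"
      then have "Poly_Mapping.lookup (v - u) j = Poly_Mapping.lookup (w i - u) j"
        by (simp add: v_def lookup_minus)
      then show "0 \<le> Poly_Mapping.lookup (w i - u) j" "Poly_Mapping.lookup (w i - u) j < d j"
        using u(2)[of j] j by auto
    qed
  qed
  then obtain p where p: "\<And>i. i \<in> {1..<r} \<Longrightarrow> p i \<in> L i"
      "\<And>i. i \<in> {1..<r} \<Longrightarrow> Poly_Mapping.lookup (p i) i = d i"
      "\<And>i j. i \<in> {1..<r} \<Longrightarrow> j \<in> {1..<i} \<Longrightarrow>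
        0 \<le> Poly_Mapping.lookup (p i) j \<and> Poly_Mapping.lookup (p i) j < d j"
    by metis
  define m where "m i j = Poly_Mapping.lookup (p i) j" for i j
  have rel: "relator m i = p i" if "i \<in> {1..<r}" for i
    by (rule poly_mapping_eqI) (use p(1)[OF that] in \<open>auto simp: L lookup_relator m_def\<close>)
  have "parameter_collection r m"
    unfolding parameter_collection_def m_def
    using p(2,3) w(2) by (fastforce simp: d_def)
  moreover have "relation_subgroup r m = N"
  proof
    show "relation_subgroup r m \<subseteq> N"
      unfolding relation_subgroup_def
      by (rule group.generate_subgroup_incl[OF _ _ N]) (use rel p(1) L in auto)
  next
    note R = subgroup_free_Abelian_groupD[OF subgroup_relation_subgroup[of r m]]
    \<comment> \<open>Elimination from the top: the entry at \<open>?i\<close> is divisible by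
      \<open>d ?i\<close>, so subtracting a multiple of row \<open>?i\<close> leaves an element
      supported one position lower.\<close>
    have gen: "v \<in> relation_subgroup r m" if "v \<in> L i" "i < r" for v i
      using that
    proof (induction i arbitrary: v)
      case 0
      then have "v = 0" by (auto simp: L intro: poly_mapping_eqI)
      then show ?case using R(1) by simp
    next
      case (Suc i)
      let ?i = "Suc i"
      have i: "?i \<in> {1..<r}" using Suc.prems(2) by simp
      define z where "z = frag_cmul (Poly_Mapping.lookup v ?i div d ?i) (p ?i)"
      have zi: "Poly_Mapping.lookup z ?i = Poly_Mapping.lookup v ?i"
        using w(3)[OF i Suc.prems(1)] p(2)[OF i] by (simp add: z_def d_def)
      have z: "z \<in> L ?i" using p(1)[OF i] N_simps unfolding L z_def by simp
      have "v - z \<in> L i"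
        unfolding L
      proof (intro conjI allI impI)
        show "v - z \<in> N" using Suc.prems(1) z N_simps by (simp add: L)
        fix j assume "j \<notin> {1..i}"
        then have "j = ?i \<or> j \<notin> {1..?i}" by auto
        then show "Poly_Mapping.lookup (v - z) j = 0"
          using zi z Suc.prems(1) by (auto simp: L lookup_minus)
      qed
      then have "v - z \<in> relation_subgroup r m" using Suc by simp
      moreover have "z \<in> relation_subgroup r m"
        unfolding z_def using R(5) relator_in_relation_subgroup[OF i] rel[OF i] by metis
      ultimately show ?case using R(2)[of "v - z" z] by simp
    qed
    show "N \<subseteq> relation_subgroup r m"
    proof
      fix v assume v: "v \<in> N"
      show "v \<in> relation_subgroup r m"
      \<comment> \<open>\<open>gen\<close> needs an index below \<open>r\<close>, and
        \<open>r - 1\<close> is one only for positive \<open>r\<close>.\<close>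
      proof (cases "r = 0")
        case True
        then have "v = 0" using N_simps(4)[OF v] by simp
        then show ?thesis using R(1) by simp
      next
        case False
        then have "{1..<r} = {1..r - 1}" by auto
        then show ?thesis using gen[of v "r - 1"] v N_simps(4)[OF v] False by (simp add: L_def)
      qed
    qed
  qed
  ultimately show ?thesis by (rule that)
qed

section \<open>Commuting permutations\<close>

text \<open>The elements commuting with a fixed \<open>x\<close> are closed under products and
  inverses, so they contain the generated subgroup once they contain \<open>S\<close>. This is
  applied first to \<open>x\<close> in \<open>S\<close>, then to \<open>x\<close> in the generated
  subgroup.\<close>

lemma (in group) comm_group_subgroup_generated:
  assumes S: "S \<subseteq> carrier G" and comm: "\<And>x y. x \<in> S \<Longrightarrow> y \<in> S \<Longrightarrow> x \<otimes> y = y \<otimes> x"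
  shows "comm_group (subgroup_generated G S)"
proof -
  have inv_comm: "inv h \<otimes> x = x \<otimes> inv h"
    if "x \<in> carrier G" "h \<in> carrier G" "h \<otimes> x = x \<otimes> h" for x h
    using that by (metis inv_closed inv_solve_left inv_solve_right m_assoc m_closed)
  have mult_comm: "h1 \<otimes> h2 \<otimes> x = x \<otimes> (h1 \<otimes> h2)"
    if "x \<in> carrier G" "h1 \<in> carrier G" "h2 \<in> carrier G" "h1 \<otimes> x = x \<otimes> h1" "h2 \<otimes> x = x \<otimes> h2"
    for x h1 h2
    using that by (metis m_assoc)
  have gen_comm: "y \<otimes> x = x \<otimes> y"
    if "x \<in> carrier G" "\<And>s. s \<in> S \<Longrightarrow> s \<otimes> x = x \<otimes> s" "y \<in> generate G S" for x y
    using that(3)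
  proof (induction rule: generate.induct)
    case (inv h)
    then show ?case using that(1,2) S by (intro inv_comm) auto
  next
    case (eng h1 h2)
    then show ?case using that(1) generate_in_carrier[OF S] by (intro mult_comm) auto
  qed (use that in auto)
  show ?thesis
  proof (rule group.group_comm_groupI)
    fix x y assume "x \<in> carrier (subgroup_generated G S)" "y \<in> carrier (subgroup_generated G S)"
    then have xy: "x \<in> generate G S" "y \<in> generate G S"
      using S by (simp_all add: carrier_subgroup_generated Int_absorb1)
    have "s \<otimes> y = y \<otimes> s" if "s \<in> S" for s
      using gen_comm[of s y] that comm S xy(2) by (metis subsetD)
    then show "x \<otimes>\<^bsub>subgroup_generated G S\<^esub> y = y \<otimes>\<^bsub>subgroup_generated G S\<^esub> x"
      using gen_comm[of y x] xy generate_in_carrier[OF S] by simp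
  qed simp
qed

text \<open>The universal property of the free abelian group asks for an abelian target, which
  \<open>BijGroup X\<close> in general is not; the subgroup generated by the commuting permutations
  serves instead.\<close>

lemma free_Abelian_group_action:
  fixes X :: "'a set" and T :: "'c \<Rightarrow> 'a \<Rightarrow> 'a"
  assumes bij: "\<And>k. k \<in> S \<Longrightarrow> bij_betw (T k) X X"
    and comm: "\<And>k l x. k \<in> S \<Longrightarrow> l \<in> S \<Longrightarrow> x \<in> X \<Longrightarrow> T k (T l x) = T l (T k x)"
  obtains \<phi> :: "('c \<Rightarrow>\<^sub>0 int) \<Rightarrow> 'a \<Rightarrow> 'a"
  where "\<And>x. x \<in> X \<Longrightarrow> \<phi> 0 x = x"
    and "\<And>v x. Poly_Mapping.keys v \<subseteq> S \<Longrightarrow> x \<in> X \<Longrightarrow> \<phi> v x \<in> X"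
    and "\<And>v w x. Poly_Mapping.keys v \<subseteq> S \<Longrightarrow> Poly_Mapping.keys w \<subseteq> S \<Longrightarrow> x \<in> X \<Longrightarrow>
           \<phi> (v + w) x = \<phi> v (\<phi> w x)"
    and "\<And>k x. k \<in> S \<Longrightarrow> x \<in> X \<Longrightarrow> \<phi> (frag_of k) x = T k x"
proof -
  let ?B = "BijGroup X"
  interpret B: group ?B by (rule group_BijGroup)
  \<comment> \<open>Elements of \<open>Bij X\<close> are extensional, hence the restriction to
    \<open>X\<close>.\<close>
  define t where "t k = restrict (T k) X" for k
  have t: "t k \<in> Bij X" if "k \<in> S" for k
    using bij[OF that] by (simp add: t_def Bij_def cong: bij_betw_cong)
  have TX: "T k x \<in> X" if "k \<in> S" "x \<in> X" for k x
    using bij[OF that(1)] that(2) by (rule bij_betwE[rule_format])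
  have mult: "g \<otimes>\<^bsub>?B\<^esub> h = compose X g h" if "g \<in> Bij X" "h \<in> Bij X" for g h
    using that by (simp add: BijGroup_def)
  have carrier: "carrier ?B = Bij X" by (simp add: BijGroup_def)
  let ?G = "subgroup_generated ?B (t ` S)"
  interpret G: comm_group ?G
  proof (rule B.comm_group_subgroup_generated)
    show "t ` S \<subseteq> carrier ?B" using t carrier by auto
    show "g \<otimes>\<^bsub>?B\<^esub> h = h \<otimes>\<^bsub>?B\<^esub> g" if "g \<in> t ` S" "h \<in> t ` S" for g h
      using that t comm TX by (auto simp: mult compose_def t_def restrict_def fun_eq_iff)
  qed
  have tG: "t ` S \<subseteq> carrier ?G"
    by (rule B.subgroup_generated_subset_carrier_subset) (use t carrier in auto)
  obtain \<phi> where \<phi>: "\<phi> \<in> hom (free_Abelian_group S) ?G" "\<And>k. k \<in> S \<Longrightarrow> \<phi> (frag_of k) = t k"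
    using G.free_Abelian_group_universal[OF tG] by blast
  interpret h: group_hom "free_Abelian_group S" ?G \<phi>
    using \<phi>(1) by (intro group_hom.intro group_hom_axioms.intro) simp_all
  have \<phi>_Bij: "\<phi> v \<in> Bij X" if "Poly_Mapping.keys v \<subseteq> S" for v
    using h.hom_closed[of v] that B.carrier_subgroup_generated_subset[of "t ` S"] carrier by auto
  show ?thesis
  proof (rule that[of \<phi>])
    show "\<phi> 0 x = x" if "x \<in> X" for x using h.hom_one that by (simp add: BijGroup_def)
    show "\<phi> v x \<in> X" if "Poly_Mapping.keys v \<subseteq> S" "x \<in> X" for v x
      using Bij_imp_funcset[OF \<phi>_Bij[OF that(1)]] that(2) by auto
    show "\<phi> (v + w) x = \<phi> v (\<phi> w x)"
      if "Poly_Mapping.keys v \<subseteq> S" "Poly_Mapping.keys w \<subseteq> S" "x \<in> X" for v w x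
      using h.hom_mult[of v w] that \<phi>_Bij by (simp add: mult compose_eq)
    show "\<phi> (frag_of k) x = T k x" if "k \<in> S" "x \<in> X" for k x
      using \<phi>(2) that by (simp add: t_def)
  qed
qed

section \<open>Ordered isomorphisms\<close>

definition param_coset :: "nat \<Rightarrow> (nat \<Rightarrow> nat \<Rightarrow> int) \<Rightarrow> (nat \<Rightarrow>\<^sub>0 int) \<Rightarrow> (nat \<Rightarrow>\<^sub>0 int) set" where
  "param_coset r m v = relation_subgroup r m #>\<^bsub>free_Abelian_group {1..<r}\<^esub> v"

lemma carrier_param_group:
  "carrier (param_group r m) = param_coset r m ` carrier (free_Abelian_group {1..<r})"
  by (auto simp: param_group_def carrier_FactGroup param_coset_def)

lemma param_coset_closed:
  "Poly_Mapping.keys v \<subseteq> {1..<r} \<Longrightarrow> param_coset r m v \<in> carrier (param_group r m)"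
  unfolding carrier_param_group by (rule imageI) simp

lemma param_coset_mult:
  assumes "Poly_Mapping.keys v \<subseteq> {1..<r}" "Poly_Mapping.keys w \<subseteq> {1..<r}"
  shows "param_coset r m v \<otimes>\<^bsub>param_group r m\<^esub> param_coset r m w = param_coset r m (v + w)"
  using normal.rcos_sum[OF relation_subgroup_normal, of v r w m] assms
  by (simp add: param_coset_def param_group_def)

lemma mem_param_coset: "u \<in> param_coset r m v \<longleftrightarrow> u - v \<in> relation_subgroup r m"
  unfolding param_coset_def r_coset_def by (auto intro!: bexI[of _ "u - v"])

lemma param_coset_eq_iff: "param_coset r m v = param_coset r m w \<longleftrightarrow> v - w \<in> relation_subgroup r m"
proof
  note R = subgroup_free_Abelian_groupD[OF subgroup_relation_subgroup[of r m]]
  show "v - w \<in> relation_subgroup r m" if "param_coset r m v = param_coset r m w"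
    using that R(1) mem_param_coset[of v r m v] mem_param_coset[of v r m w] by simp
  assume vw: "v - w \<in> relation_subgroup r m"
  have "u - v \<in> relation_subgroup r m \<longleftrightarrow> u - w \<in> relation_subgroup r m" for u
    using R(2)[OF _ vw, of "u - v"] R(3)[OF _ vw, of "u - w"] by auto
  then show "param_coset r m v = param_coset r m w" by (auto simp: mem_param_coset)
qed

lemma param_gen_eq_param_coset:
  "param_gen r m k = param_coset r m (if k = 0 then 0 else frag_of k)"
  using subgroup.subset[OF subgroup_relation_subgroup[of r m]]
    group.coset_mult_one[OF group_free_Abelian_group, of "relation_subgroup r m" "{1..<r}"]
  by (simp add: param_gen_def param_coset_def param_group_def)

text \<open>Addition modulo \<open>r\<close> with representatives \<open>1\<close> to
  \<open>r\<close>: the orbit whose action on orbit \<open>i\<close> is multiplication by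
  \<open>x_k\<close>.\<close>

definition cyc_index :: "nat \<Rightarrow> nat \<Rightarrow> nat \<Rightarrow> nat" where
  "cyc_index r i k = (if i + k \<le> r then i + k else i + k - r)"

lemma cyc_index_mem: "i \<in> {1..r} \<Longrightarrow> k < r \<Longrightarrow> cyc_index r i k \<in> {1..r}"
  by (auto simp: cyc_index_def)

text \<open>Together with \<open>cyc_index_of_diff\<close> this makes \<open>cyc_index r i\<close>
  inverse to the residue taken in \<open>fp_op\<close>.\<close>

lemma cyc_index_diff:
  assumes "i \<in> {1..r}" "k < r"
  shows "nat ((int (cyc_index r i k) - int i) mod int r) = k"
proof (cases "i + k \<le> r")
  case True
  then show ?thesis using assms by (simp add: cyc_index_def)
next
  case False
  then have "int (cyc_index r i k) - int i = int k - int r" by (simp add: cyc_index_def of_nat_diff)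
  then show ?thesis using assms(2) by (simp only: minus_mod_self2) simp
qed

lemma cyc_index_of_diff:
  assumes i: "i \<in> {1..r}" and j: "j \<in> {1..r}"
  shows "cyc_index r i (nat ((int j - int i) mod int r)) = j"
proof (cases "i \<le> j")
  case True
  then have "(int j - int i) mod int r = int j - int i" using i j by simp
  then show ?thesis using True j by (simp add: cyc_index_def nat_diff_distrib)
next
  case False
  have "(int j - int i) mod int r = (int j - int i + int r) mod int r" by simp
  also have "\<dots> = int j - int i + int r" using False i j by (intro mod_pos_pos_trivial) auto
  finally have "nat ((int j - int i) mod int r) = j + r - i" using False i by simp
  then show ?thesis using False i j by (auto simp: cyc_index_def)
qed

text \<open>The map \<open>g\<close> induced on component \<open>i\<close> need not be a
  homomorphism, but it commutes with translation by every \<open>v\<close>. So \<open>v\<close>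
  fixes the identity iff it fixes the image of the identity, and in a group each of these says that
  \<open>v\<close> lies in the respective relation subgroup.\<close>

lemma orbit_order_iso_relation_subgroup_eq:
  assumes f: "orbit_order_iso r M M' f" and i: "i \<in> {1..r}"
  shows "relation_subgroup r (M i) = relation_subgroup r (M' i)"
proof -
  let ?G = "param_group r (M i)" and ?G' = "param_group r (M' i)"
  let ?q = "param_coset r (M i)" and ?q' = "param_coset r (M' i)"
  interpret G: comm_group ?G by (rule comm_group_param_group)
  interpret G': comm_group ?G' by (rule comm_group_param_group)
  have inj: "inj_on f (fp_carrier r M)"
    and hom: "\<And>a b. a \<in> fp_carrier r M \<Longrightarrow> b \<in> fp_carrier r M \<Longrightarrow>
                 f (fp_op r M a b) = fp_op r M' (f a) (f b)"
    and comp: "\<And>j. j \<in> {1..r} \<Longrightarrow> f ` fp_component r M j = fp_component r M' j"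
    using f by (auto simp: orbit_order_iso_def quandle_iso_def bij_betw_def)
  define g where "g A = snd (f (i, A))" for A
  have sub: "(j, A) \<in> fp_component r M j \<and> (j, A) \<in> fp_carrier r M"
    if "j \<in> {1..r}" "A \<in> carrier (param_group r (M j))" for j A
    using that by (auto simp: fp_carrier_def fp_component_def)
  have fg: "f (i, A) = (i, g A)" "g A \<in> carrier ?G'" if "A \<in> carrier ?G" for A
  proof -
    have "f (i, A) \<in> fp_component r M' i" using comp[OF i] sub[OF i that] by blast
    then show "f (i, A) = (i, g A)" "g A \<in> carrier ?G'" by (auto simp: fp_component_def g_def)
  qed
  have gen: "g (A \<otimes>\<^bsub>?G\<^esub> ?q (frag_of k)) = g A \<otimes>\<^bsub>?G'\<^esub> ?q' (frag_of k)"
    if A: "A \<in> carrier ?G" and k: "k \<in> {1..<r}" for A k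
  proof -
    define j where "j = cyc_index r i k"
    have j: "j \<in> {1..r}" using cyc_index_mem[OF i] k by (simp add: j_def)
    have jk: "nat ((int j - int i) mod int r) = k" using cyc_index_diff[OF i] k by (simp add: j_def)
    have x: "param_gen r (M i) k = ?q (frag_of k)" "param_gen r (M' i) k = ?q' (frag_of k)"
      using k by (simp_all add: param_gen_eq_param_coset)
    interpret H: comm_group "param_group r (M j)" by (rule comm_group_param_group)
    \<comment> \<open>Any element of component \<open>j\<close> would do: \<open>fp_op\<close> reads
      only the index of its right argument, and \<open>f\<close> keeps that index.\<close>
    define b where "b = (j, \<one>\<^bsub>param_group r (M j)\<^esub>)"
    have b: "b \<in> fp_component r M j" "b \<in> fp_carrier r M" using sub[OF j H.one_closed] by (simp_all add: b_def)
    have "f b \<in> fp_component r M' j" using comp[OF j] b(1) by blast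
    then obtain B where B: "f b = (j, B)" by (auto simp: fp_component_def)
    have "A \<otimes>\<^bsub>?G\<^esub> ?q (frag_of k) \<in> carrier ?G"
      using A k by (intro G.m_closed param_coset_closed) auto
    then have "(i, g (A \<otimes>\<^bsub>?G\<^esub> ?q (frag_of k))) = f (i, A \<otimes>\<^bsub>?G\<^esub> ?q (frag_of k))" using fg(1) by simp
    also have "\<dots> = f (fp_op r M (i, A) b)"
      by (simp only: fp_op_def b_def case_prod_conv jk x)
    also have "\<dots> = fp_op r M' (i, g A) (j, B)"
      using hom[of "(i, A)" b] sub[OF i A] b(2) fg(1)[OF A] B by simp
    also have "\<dots> = (i, g A \<otimes>\<^bsub>?G'\<^esub> ?q' (frag_of k))"
      by (simp only: fp_op_def case_prod_conv jk x)
    finally show ?thesis by simp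
  qed
  \<comment> \<open>Quantifying over all \<open>A\<close> matters: the hypothesis for
    \<open>y\<close> is used at the point translated by \<open>x - y\<close>, after which
    \<open>y\<close> cancels.\<close>
  have equivariant: "\<forall>A\<in>carrier ?G. g (A \<otimes>\<^bsub>?G\<^esub> ?q v) = g A \<otimes>\<^bsub>?G'\<^esub> ?q' v"
    if "Poly_Mapping.keys v \<subseteq> {1..<r}" for v
    using that
  proof (rule free_Abelian_group_induct)
    have "?q 0 = \<one>\<^bsub>?G\<^esub>" "?q' 0 = \<one>\<^bsub>?G'\<^esub>"
      using param_gen_eq_param_coset[of r "M i" 0] param_gen_eq_param_coset[of r "M' i" 0]
      by (simp_all add: param_gen_def)
    then show "\<forall>A\<in>carrier ?G. g (A \<otimes>\<^bsub>?G\<^esub> ?q 0) = g A \<otimes>\<^bsub>?G'\<^esub> ?q' 0" using fg(2) by simp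
  next
    fix x y :: "nat \<Rightarrow>\<^sub>0 int"
    assume xy: "Poly_Mapping.keys x \<subseteq> {1..<r}" "Poly_Mapping.keys y \<subseteq> {1..<r}"
      and IH: "\<forall>A\<in>carrier ?G. g (A \<otimes>\<^bsub>?G\<^esub> ?q x) = g A \<otimes>\<^bsub>?G'\<^esub> ?q' x"
        "\<forall>A\<in>carrier ?G. g (A \<otimes>\<^bsub>?G\<^esub> ?q y) = g A \<otimes>\<^bsub>?G'\<^esub> ?q' y"
    have d: "Poly_Mapping.keys (x - y) \<subseteq> {1..<r}" using keys_diff[of x y] xy by blast
    show "\<forall>A\<in>carrier ?G. g (A \<otimes>\<^bsub>?G\<^esub> ?q (x - y)) = g A \<otimes>\<^bsub>?G'\<^esub> ?q' (x - y)"
    proof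
      fix A assume A: "A \<in> carrier ?G"
      have c: "A \<otimes>\<^bsub>?G\<^esub> ?q (x - y) \<in> carrier ?G" using A d by (intro G.m_closed param_coset_closed)
      have "g (A \<otimes>\<^bsub>?G\<^esub> ?q (x - y)) \<otimes>\<^bsub>?G'\<^esub> ?q' y = g (A \<otimes>\<^bsub>?G\<^esub> ?q (x - y) \<otimes>\<^bsub>?G\<^esub> ?q y)"
        using IH(2) c by simp
      also have "A \<otimes>\<^bsub>?G\<^esub> ?q (x - y) \<otimes>\<^bsub>?G\<^esub> ?q y = A \<otimes>\<^bsub>?G\<^esub> ?q x"
        using A d xy param_coset_mult[OF d xy(2), of "M i"] by (simp add: G.m_assoc param_coset_closed)
      also have "g (A \<otimes>\<^bsub>?G\<^esub> ?q x) = g A \<otimes>\<^bsub>?G'\<^esub> (?q' (x - y) \<otimes>\<^bsub>?G'\<^esub> ?q' y)"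
        using IH(1) A param_coset_mult[OF d xy(2), of "M' i"] by simp
      also have "\<dots> = g A \<otimes>\<^bsub>?G'\<^esub> ?q' (x - y) \<otimes>\<^bsub>?G'\<^esub> ?q' y"
        using fg(2)[OF A] d xy by (simp add: G'.m_assoc param_coset_closed)
      finally show "g (A \<otimes>\<^bsub>?G\<^esub> ?q (x - y)) = g A \<otimes>\<^bsub>?G'\<^esub> ?q' (x - y)"
        using fg(2)[OF c] fg(2)[OF A] d xy by (simp add: param_coset_closed)
    qed
  qed (use gen in blast)
  have ginj: "A = B" if "g A = g B" "A \<in> carrier ?G" "B \<in> carrier ?G" for A B
  proof -
    have "f (i, A) = f (i, B)" using fg(1) that by simp
    then show ?thesis using inj_onD[OF inj] sub[OF i] that(2,3) by blast
  qed
  have one: "?q 0 = \<one>\<^bsub>?G\<^esub>" "?q' 0 = \<one>\<^bsub>?G'\<^esub>"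
    using param_gen_eq_param_coset[of r "M i" 0] param_gen_eq_param_coset[of r "M' i" 0]
    by (simp_all add: param_gen_def)
  have "v \<in> relation_subgroup r (M i) \<longleftrightarrow> v \<in> relation_subgroup r (M' i)"
    if v: "Poly_Mapping.keys v \<subseteq> {1..<r}" for v
  proof -
    have "v \<in> relation_subgroup r (M i) \<longleftrightarrow> ?q v = \<one>\<^bsub>?G\<^esub>"
      using param_coset_eq_iff[of r "M i" v 0] one by simp
    also have "\<dots> \<longleftrightarrow> g (?q v) = g \<one>\<^bsub>?G\<^esub>" using ginj param_coset_closed[OF v] by auto
    also have "g (?q v) = g \<one>\<^bsub>?G\<^esub> \<otimes>\<^bsub>?G'\<^esub> ?q' v"
      using equivariant[OF v, rule_format, OF G.one_closed] param_coset_closed[OF v] by simp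
    \<comment> \<open>Left cancellation: the possibly nontrivial image of the identity drops out
      here.\<close>
    also have "\<dots> = g \<one>\<^bsub>?G\<^esub> \<longleftrightarrow> ?q' v = \<one>\<^bsub>?G'\<^esub>"
      using fg(2)[OF G.one_closed] param_coset_closed[OF v] by simp
    also have "\<dots> \<longleftrightarrow> v \<in> relation_subgroup r (M' i)"
      using param_coset_eq_iff[of r "M' i" v 0] one by simp
    finally show ?thesis .
  qed
  then show ?thesis
    using subgroup_free_Abelian_groupD(4)[OF subgroup_relation_subgroup] by blast
qed

text \<open>Groups, generators and components depend on the parameters only through the relation
  subgroups, so the two quandles coincide literally and the identity serves.\<close>

lemma same_parameters_orbit_order_iso:
  assumes "\<forall>i\<in>{1..r}. same_parameters r (M i) (M' i)"
  shows "orbit_order_iso r M M' id"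
proof -
  have N: "relation_subgroup r (M i) = relation_subgroup r (M' i)" if "i \<in> {1..r}" for i
    using assms that relation_subgroup_cong by blast
  have G: "param_group r (M i) = param_group r (M' i)" if "i \<in> {1..r}" for i
    using N[OF that] by (simp add: param_group_def)
  have gen: "param_gen r (M i) k = param_gen r (M' i) k" if "i \<in> {1..r}" for i k
    using N[OF that] G[OF that] by (simp add: param_gen_def)
  have comp: "fp_component r M i = fp_component r M' i" if "i \<in> {1..r}" for i
    using G[OF that] by (simp add: fp_component_def)
  have op: "fp_op r M a b = fp_op r M' a b" if "a \<in> fp_carrier r M" for a b
  proof -
    obtain i A j B where ab: "a = (i, A)" "b = (j, B)" by (metis surj_pair)
    have "i \<in> {1..r}" using that by (auto simp: ab fp_carrier_def fp_component_def)
    then show ?thesis using G gen by (simp add: ab fp_op_def)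
  qed
  have "fp_carrier r M = fp_carrier r M'" using comp by (simp add: fp_carrier_def)
  then show ?thesis using comp op by (simp add: orbit_order_iso_def quandle_iso_def)
qed

section \<open>Abelian quandles\<close>

text \<open>A transitive action of a free abelian group is regular modulo the stabilizer \<open>N\<close> of a point,
  so sending a point to the set of group elements that move the base point there identifies the
  underlying set with the cosets of \<open>N\<close>.\<close>

lemma transitive_permutations_param_group:
  fixes Y :: "'a set" and T :: "nat \<Rightarrow> 'a \<Rightarrow> 'a"
  assumes fin: "finite Y" and e: "e \<in> Y"
    and bij: "\<And>k. k \<in> {1..<r} \<Longrightarrow> bij_betw (T k) Y Y"
    and comm: "\<And>k l x. k \<in> {1..<r} \<Longrightarrow> l \<in> {1..<r} \<Longrightarrow> x \<in> Y \<Longrightarrow> T k (T l x) = T l (T k x)"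
    and trans: "\<And>U. e \<in> U \<Longrightarrow> U \<subseteq> Y \<Longrightarrow> (\<And>k. k \<in> {1..<r} \<Longrightarrow> T k ` U = U) \<Longrightarrow> U = Y"
  obtains m c where "parameter_collection r m" "bij_betw c Y (carrier (param_group r m))"
    "\<And>k x. k \<in> {1..<r} \<Longrightarrow> x \<in> Y \<Longrightarrow> c (T k x) = c x \<otimes>\<^bsub>param_group r m\<^esub> param_gen r m k"
proof -
  let ?K = "\<lambda>v::nat \<Rightarrow>\<^sub>0 int. Poly_Mapping.keys v \<subseteq> {1..<r}"
  obtain \<phi> :: "(nat \<Rightarrow>\<^sub>0 int) \<Rightarrow> 'a \<Rightarrow> 'a" where
        \<phi>0: "\<And>x. x \<in> Y \<Longrightarrow> \<phi> 0 x = x"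
    and \<phi>Y: "\<And>v x. ?K v \<Longrightarrow> x \<in> Y \<Longrightarrow> \<phi> v x \<in> Y"
    and \<phi>add: "\<And>v w x. ?K v \<Longrightarrow> ?K w \<Longrightarrow> x \<in> Y \<Longrightarrow> \<phi> (v + w) x = \<phi> v (\<phi> w x)"
    and \<phi>gen: "\<And>k x. k \<in> {1..<r} \<Longrightarrow> x \<in> Y \<Longrightarrow> \<phi> (frag_of k) x = T k x"
    using free_Abelian_group_action[of "{1..<r}" T Y] bij comm by blast
  have Kadd: "?K (v + w)" and Kdiff: "?K (v - w)" if "?K v" "?K w" for v w
    using that Poly_Mapping.keys_add[of v w] keys_diff[of v w] by blast+
  have transfer: "\<phi> v e = \<phi> w e \<longleftrightarrow> \<phi> (v - w) e = e" if "?K v" "?K w" for v w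
  proof
    have "\<phi> v e = \<phi> w (\<phi> (v - w) e)" using \<phi>add[of w "v - w" e] Kdiff that e by simp
    then show "\<phi> v e = \<phi> w e" if "\<phi> (v - w) e = e" using that by simp
    assume eq: "\<phi> v e = \<phi> w e"
    have "\<phi> (v - w) e = \<phi> (- w) (\<phi> v e)" using \<phi>add[of "- w" v e] that e by simp
    also have "\<dots> = e" unfolding eq using \<phi>add[of "- w" w e] that e \<phi>0 by simp
    finally show "\<phi> (v - w) e = e" .
  qed
  have surj: "\<exists>v. ?K v \<and> \<phi> v e = x" if "x \<in> Y" for x
  proof -
    \<comment> \<open>The orbit of \<open>e\<close> under the action. \<open>trans\<close> asks for
      invariance as an equality, so each point also needs a preimage, found by subtracting
      \<open>frag_of k\<close>.\<close>
    let ?U = "{\<phi> v e |v. ?K v}"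
    have "?U = Y"
    proof (rule trans)
      show "e \<in> ?U" using \<phi>0[OF e] by (auto intro!: exI[of _ 0])
      show "?U \<subseteq> Y" using \<phi>Y e by blast
      fix k assume k: "k \<in> {1..<r}"
      then have Kk: "?K (frag_of k)" by simp
      have step: "T k (\<phi> v e) = \<phi> (frag_of k + v) e" if "?K v" for v
        using \<phi>add[OF Kk that e] \<phi>gen[OF k \<phi>Y[OF that e]] by simp
      show "T k ` ?U = ?U"
      proof (intro equalityI subsetI)
        fix y assume "y \<in> T k ` ?U"
        then show "y \<in> ?U" using step Kadd[OF Kk] by blast
      next
        fix y assume "y \<in> ?U"
        then obtain v where v: "?K v" "y = \<phi> v e" by blast
        have "T k (\<phi> (v - frag_of k) e) = y" using step[OF Kdiff[OF v(1) Kk]] v(2) by simp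
        then show "y \<in> T k ` ?U" using Kdiff[OF v(1) Kk] by blast
      qed
    qed
    then show ?thesis using that by blast
  qed
  define N where "N = {v. ?K v \<and> \<phi> v e = e}"
  have "subgroup N (free_Abelian_group {1..<r})"
  proof (rule group.subgroupI)
    show "N \<noteq> {}" using \<phi>0[OF e] by (auto simp: N_def intro!: exI[of _ 0])
    show "inv\<^bsub>free_Abelian_group {1..<r}\<^esub> v \<in> N" if "v \<in> N" for v
      using that transfer[of 0 v] \<phi>0[OF e] by (simp add: N_def)
    show "v \<otimes>\<^bsub>free_Abelian_group {1..<r}\<^esub> w \<in> N" if "v \<in> N" "w \<in> N" for v w
      using that Kadd \<phi>add e by (simp add: N_def)
  qed (auto simp: N_def)
  moreover have "\<exists>n>0. frag_cmul n (frag_of k) \<in> N" if k: "k \<in> {1..<r}" for k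
  proof -
    let ?p = "\<lambda>n::nat. frag_cmul (int n) (frag_of k)"
    have Kp: "?K (?p n)" for n using k keys_cmul[of "int n" "frag_of k"] by auto
    have "range (\<lambda>n. \<phi> (?p n) e) \<subseteq> Y" using \<phi>Y[OF Kp e] by blast
    \<comment> \<open>Pigeonhole: two multiples of \<open>frag_of k\<close> agree at
      \<open>e\<close>, so their difference fixes it. This gives \<open>N\<close> finite
      index.\<close>
    then have "\<not> inj (\<lambda>n. \<phi> (?p n) e)"
      using finite_imageD[of "\<lambda>n. \<phi> (?p n) e" UNIV] finite_subset[OF _ fin] infinite_UNIV_nat by blast
    then obtain n l where "n \<noteq> l" "\<phi> (?p n) e = \<phi> (?p l) e" by (auto simp: inj_def)
    then obtain n l where nl: "l < n" "\<phi> (?p n) e = \<phi> (?p l) e" by (metis nat_neq_iff)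
    then have "?p n - ?p l \<in> N" using transfer[OF Kp Kp] Kdiff[OF Kp Kp] by (simp add: N_def)
    then have "frag_cmul (int n - int l) (frag_of k) \<in> N" by (simp add: frag_cmul_diff_distrib)
    then show ?thesis using nl(1) by (intro exI[of _ "int n - int l"]) simp
  qed
  ultimately obtain m where m: "parameter_collection r m" "relation_subgroup r m = N"
    by (rule ex_parameter_collection)
  define c where "c x = {v. ?K v \<and> \<phi> v e = x}" for x
  have c: "c (\<phi> w e) = param_coset r m w" if w: "?K w" for w
  proof -
    have "v - w \<in> N \<longleftrightarrow> ?K v \<and> \<phi> v e = \<phi> w e" for v
      using transfer[OF _ w, of v] Kdiff[OF _ w, of v] Kadd[OF _ w, of "v - w"] by (auto simp: N_def)
    then show ?thesis unfolding c_def set_eq_iff mem_param_coset m(2) by blast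
  qed
  show ?thesis
  proof (rule that[OF m(1)])
    show "bij_betw c Y (carrier (param_group r m))"
      unfolding bij_betw_def
    proof (intro conjI inj_onI equalityI subsetI)
      fix x y assume "x \<in> Y" "y \<in> Y" "c x = c y"
      \<comment> \<open>Distinct points have disjoint fibres, and \<open>surj\<close> makes each
        fibre nonempty.\<close>
      then show "x = y" using surj[of x] by (auto simp: c_def set_eq_iff)
    next
      fix A assume "A \<in> c ` Y"
      then show "A \<in> carrier (param_group r m)" using surj c param_coset_closed by (metis imageE)
    next
      fix A assume "A \<in> carrier (param_group r m)"
      then obtain w where "?K w" "A = param_coset r m w" by (auto simp: carrier_param_group)
      then show "A \<in> c ` Y" using c \<phi>Y[OF _ e] by blast
    qed
    fix k x assume k: "k \<in> {1..<r}" and x: "x \<in> Y"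
    obtain v where v: "?K v" "x = \<phi> v e" using surj[OF x] by blast
    have Kk: "?K (frag_of k)" using k by simp
    have "T k x = \<phi> (frag_of k + v) e"
      using \<phi>add[OF Kk v(1) e] \<phi>gen[OF k x] v(2) by simp
    then have "c (T k x) = param_coset r m (v + frag_of k)"
      using c[OF Kadd[OF Kk v(1)]] by (simp add: add.commute)
    also have "\<dots> = c x \<otimes>\<^bsub>param_group r m\<^esub> param_gen r m k"
      using k c[OF v(1)] param_coset_mult[OF v(1) Kk] v(2) by (simp add: param_gen_eq_param_coset)
    finally show "c (T k x) = c x \<otimes>\<^bsub>param_group r m\<^esub> param_gen r m k" .
  qed
qed

section \<open>Equivalence of the three conditions\<close>

lemma (in quandle) closed: "a \<in> X \<Longrightarrow> b \<in> X \<Longrightarrow> tri a b \<in> X"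
  using bij_betwE[OF bij_right] by blast

text \<open>Self-distributivity rewrites \<open>tri (tri a c) (tri b c)\<close> as
  \<open>tri (tri a b) c\<close>. Commutation turns this into \<open>tri (tri a c) b\<close>, where
  \<open>tri a c\<close> is arbitrary because right translation by \<open>c\<close> is onto.
  Conversely, 2-reductivity removes the inner \<open>c\<close> directly.\<close>

lemma (in quandle) abelian_iff_two_reductive: "abelian_quandle X tri \<longleftrightarrow> two_reductive_quandle X tri"
proof
  assume "abelian_quandle X tri"
  then have ab: "tri (tri a b) c = tri (tri a c) b" if "a \<in> X" "b \<in> X" "c \<in> X" for a b c
    using that by (simp add: abelian_quandle_def)
  have "tri a (tri b c) = tri a b" if abc: "a \<in> X" "b \<in> X" "c \<in> X" for a b c
  proof -
    obtain a' where a': "a' \<in> X" "a = tri a' c"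
      using bij_right[OF abc(3)] abc(1) by (auto simp: bij_betw_def)
    then show ?thesis using self_distrib[of a' b c] ab[of a' b c] abc by simp
  qed
  then show "two_reductive_quandle X tri"
    using quandle_axioms by (simp add: two_reductive_quandle_def)
next
  assume "two_reductive_quandle X tri"
  then have "tri (tri a b) c = tri (tri a c) b" if "a \<in> X" "b \<in> X" "c \<in> X" for a b c
    using that self_distrib[of a b c] closed by (simp add: two_reductive_quandle_def)
  then show "abelian_quandle X tri"
    using quandle_axioms by (simp add: abelian_quandle_def)
qed

text \<open>\<open>fp_op\<close> reads only the component index of its right argument and never
  changes that of its left one; injectivity of the isomorphism carries this back to
  \<open>X\<close>.\<close>

lemma (in quandle) filtered_permutation_imp_two_reductive:
  assumes "is_filtered_permutation_quandle X tri"
  shows "two_reductive_quandle X tri"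
proof -
  obtain r M f where f: "inj_on f X"
    "\<And>a b. a \<in> X \<Longrightarrow> b \<in> X \<Longrightarrow> f (tri a b) = fp_op r M (f a) (f b)"
    using assms by (auto simp: is_filtered_permutation_quandle_def quandle_iso_def bij_betw_def)
  have op: "fp_op r M p (fp_op r M q s) = fp_op r M p q" for p q s
    by (cases p; cases q; cases s) (simp add: fp_op_def)
  have "tri a (tri b c) = tri a b" if "a \<in> X" "b \<in> X" "c \<in> X" for a b c
    by (rule inj_onD[OF f(1)]) (use that f(2) op closed in simp_all)
  then show ?thesis using quandle_axioms by (simp add: two_reductive_quandle_def)
qed

lemma (in quandle) two_reductive_imp_filtered_permutation:
  assumes fin: "finite X" and card: "2 \<le> card X" and red: "two_reductive_quandle X tri"
  shows "is_filtered_permutation_quandle X tri"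
proof -
  have red: "tri a (tri b c) = tri a b" if "a \<in> X" "b \<in> X" "c \<in> X" for a b c
    using red that by (simp add: two_reductive_quandle_def)
  have ab: "tri (tri a b) c = tri (tri a c) b" if "a \<in> X" "b \<in> X" "c \<in> X" for a b c
    using self_distrib[of a b c] red[of "tri a c" b c] that closed by simp
  define R where "R = {(x, tri x b) |x b. x \<in> X \<and> b \<in> X}"
  let ?E = "(R \<union> R\<inverse>)\<^sup>*"
  define O' where "O' x = ?E `` {x}" for x
  have sym: "sym ?E" by (intro sym_rtrancl sym_Un_converse)
  have O_eq: "O' x = O' y \<longleftrightarrow> (x, y) \<in> ?E" for x y
    unfolding O'_def using symD[OF sym] by (auto intro: rtrancl_trans)
  have tri_E: "(x, tri x b) \<in> ?E" if "x \<in> X" "b \<in> X" for x b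
    using that by (auto simp: R_def)
  have E_X: "y \<in> X" if "(x, y) \<in> ?E" "x \<in> X" for x y
    using that by induction (auto simp: R_def closed)
  \<comment> \<open>2-reductivity lets the right argument move along a step of \<open>R\<close> in
    either direction, hence through its whole orbit.\<close>
  have E_tri: "tri a y = tri a x" if "(x, y) \<in> ?E" "x \<in> X" "a \<in> X" for a x y
    using that(1) by induction (use that(3) red in \<open>auto simp: R_def\<close>)
  define r where "r = card (O' ` X)"
  obtain h where h: "bij_betw h {1..r} (O' ` X)"
    unfolding r_def using ex_bij_betw_nat_finite_1[of "O' ` X"] fin by blast
  define ix where "ix x = the_inv_into {1..r} h (O' x)" for x
  have ix: "ix x \<in> {1..r}" "h (ix x) = O' x" if "x \<in> X" for x
    using that bij_betwE[OF bij_betw_the_inv_into[OF h]] f_the_inv_into_f_bij_betw[OF h]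
    by (auto simp: ix_def)
  have ix_eq: "ix x = ix y \<longleftrightarrow> (x, y) \<in> ?E" if "x \<in> X" "y \<in> X" for x y
    using ix[OF that(1)] ix[OF that(2)] O_eq by (metis ix_def)
  have "\<exists>e. e \<in> X \<and> ix e = i" if i: "i \<in> {1..r}" for i
  proof -
    obtain x where x: "x \<in> X" "h i = O' x" using bij_betwE[OF h] i by blast
    then have "ix x = i" using the_inv_into_f_f[OF bij_betw_imp_inj_on[OF h] i] by (simp add: ix_def)
    then show ?thesis using x(1) by blast
  qed
  \<comment> \<open>\<open>e i\<close> serves twice: as the acting representative of orbit
    \<open>i\<close> and as its base point.\<close>
  then obtain e where e: "\<And>i. i \<in> {1..r} \<Longrightarrow> e i \<in> X" "\<And>i. i \<in> {1..r} \<Longrightarrow> ix (e i) = i" by metis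
  have tri_e: "tri a (e (ix b)) = tri a b" if "a \<in> X" "b \<in> X" for a b
    using E_tri[of b "e (ix b)" a] ix_eq[of b "e (ix b)"] e ix(1) that by simp
  have ix_tri: "ix (tri a b) = ix a" if "a \<in> X" "b \<in> X" for a b
    using ix_eq[of a "tri a b"] tri_E that closed by simp
  \<comment> \<open>\<open>b\<close> may be replaced by the representative of its orbit, hence by
    \<open>a\<close>, and idempotence applies.\<close>
  have tri_same: "tri a b = a" if "a \<in> X" "b \<in> X" "ix a = ix b" for a b
    using tri_e[of a b] tri_e[of a a] that idem by simp

  \<comment> \<open>With at most one orbit all translations are trivial, so orbits are single points
    and \<open>X\<close> has at most one element.\<close>
  have "r \<ge> 2"
  proof (rule ccontr)
    assume "\<not> r \<ge> 2"
    then have all: "ix x = ix y" if "x \<in> X" "y \<in> X" for x y using ix(1)[OF that(1)] ix(1)[OF that(2)] by simp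
    have triv: "tri x b = x" if "x \<in> X" "b \<in> X" for x b
      using tri_same[OF that all[OF that]] .
    have "y = x" if "(x, y) \<in> ?E" for x y
      using that by induction (auto simp: R_def triv)
    then have "x = y" if "x \<in> X" "y \<in> X" for x y using all ix_eq that by metis
    then have "card X \<le> Suc 0" using fin by (simp add: card_le_Suc0_iff_eq)
    then show False using card by simp
  qed

  have orbit: "\<exists>m c. parameter_collection r m \<and>
      bij_betw c {x \<in> X. ix x = i} (carrier (param_group r m)) \<and>
      (\<forall>k\<in>{1..<r}. \<forall>x\<in>{x \<in> X. ix x = i}.
         c (tri x (e (cyc_index r i k))) = c x \<otimes>\<^bsub>param_group r m\<^esub> param_gen r m k)"
    if i: "i \<in> {1..r}" for i
  proof -
    let ?Y = "{x \<in> X. ix x = i}"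
    let ?T = "\<lambda>k x. tri x (e (cyc_index r i k))"
    have ek: "e (cyc_index r i k) \<in> X" if "k \<in> {1..<r}" for k
      using e(1) cyc_index_mem[OF i] that by simp
    have bij: "bij_betw (?T k) ?Y ?Y" if "k \<in> {1..<r}" for k
    proof -
      have inj: "inj_on (?T k) ?Y"
        using bij_right[OF ek[OF that]] by (auto simp: bij_betw_def intro: inj_on_subset)
      moreover have "?T k ` ?Y \<subseteq> ?Y" using ek[OF that] closed ix_tri by auto
      ultimately show ?thesis using fin by (simp add: bij_betw_def endo_inj_surj)
    qed
    show ?thesis
    proof (rule transitive_permutations_param_group[of ?Y "e i" r ?T])
      show "finite ?Y" using fin by simp
      show "e i \<in> ?Y" using e i by simp
      show "bij_betw (?T k) ?Y ?Y" if "k \<in> {1..<r}" for k by (rule bij[OF that])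
      show "?T k (?T l x) = ?T l (?T k x)" if "k \<in> {1..<r}" "l \<in> {1..<r}" "x \<in> ?Y" for k l x
        using ab ek that by simp
      fix U assume U: "e i \<in> U" "U \<subseteq> ?Y" "\<And>k. k \<in> {1..<r} \<Longrightarrow> ?T k ` U = U"
      \<comment> \<open>Invariance under the maps \<open>?T k\<close> extends to all translations:
        elements of orbit \<open>i\<close> act trivially, and any other acts as some
        \<open>?T k\<close>. Both directions are needed because paths in \<open>?E\<close> also run
        backwards.\<close>
      have tri_U: "tri x b \<in> U \<longleftrightarrow> x \<in> U" if x: "x \<in> ?Y" and b: "b \<in> X" for x b
      proof (cases "ix b = i")
        case True
        then show ?thesis using tri_same x b by simp
      next
        case False
        define k where "k = nat ((int (ix b) - int i) mod int r)"
        have kb: "cyc_index r i k = ix b" unfolding k_def by (rule cyc_index_of_diff[OF i ix(1)[OF b]])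
        have "k \<noteq> 0" using kb False i by (auto simp: cyc_index_def split: if_splits)
        moreover have "k < r" using i by (simp add: k_def nat_less_iff)
        ultimately have k: "k \<in> {1..<r}" by simp
        have T: "?T k x = tri x b" using tri_e x b kb by simp
        show ?thesis
          using U(3)[OF k] inj_on_image_mem_iff[OF bij_betw_imp_inj_on[OF bij[OF k]] x U(2)] T by simp
      qed
      have "y \<in> U" if y: "y \<in> ?Y" for y
      proof -
        have "(e i, y) \<in> ?E" using ix_eq[of "e i" y] e i y by simp
        then have "y \<in> U \<and> y \<in> ?Y"
        proof induction
          case base
          then show ?case using U(1,2) by blast
        next
          case (step y z)
          from step.hyps(2) show ?case
          proof
            assume "(y, z) \<in> R"
            then obtain b where "b \<in> X" "z = tri y b" by (auto simp: R_def)
            then show ?thesis using step.IH tri_U closed ix_tri by auto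
          next
            assume "(y, z) \<in> R\<inverse>"
            then obtain b where b: "z \<in> X" "b \<in> X" "y = tri z b" by (auto simp: R_def)
            then have "z \<in> ?Y" using step.IH ix_tri by auto
            then show ?thesis using step.IH tri_U b by blast
          qed
        qed
        then show ?thesis ..
      qed
      then show "U = ?Y" using U(2) by blast
    next
      fix m c assume "parameter_collection r m" "bij_betw c ?Y (carrier (param_group r m))"
        "\<And>k x. k \<in> {1..<r} \<Longrightarrow> x \<in> ?Y \<Longrightarrow> c (?T k x) = c x \<otimes>\<^bsub>param_group r m\<^esub> param_gen r m k"
      then show ?thesis by (intro exI[of _ m] exI[of _ c] conjI ballI)
    qed
  qed
  define P where "P i m c \<longleftrightarrow> parameter_collection r m \<and>
      bij_betw c {x \<in> X. ix x = i} (carrier (param_group r m)) \<and>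
      (\<forall>k\<in>{1..<r}. \<forall>x\<in>{x \<in> X. ix x = i}.
         c (tri x (e (cyc_index r i k))) = c x \<otimes>\<^bsub>param_group r m\<^esub> param_gen r m k)" for i m c
  have "\<forall>i\<in>{1..r}. \<exists>m c. P i m c" using orbit unfolding P_def by blast
  then obtain M c where P: "\<And>i. i \<in> {1..r} \<Longrightarrow> P i (M i) (c i)" by metis
  have M: "parameter_collection r (M i)"
    and c: "bij_betw (c i) {x \<in> X. ix x = i} (carrier (param_group r (M i)))" if "i \<in> {1..r}" for i
    using P[OF that] by (simp_all add: P_def)
  have cT: "c i (tri x (e (cyc_index r i k))) = c i x \<otimes>\<^bsub>param_group r (M i)\<^esub> param_gen r (M i) k"
    if "i \<in> {1..r}" "k \<in> {1..<r}" "x \<in> X" "ix x = i" for i k x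
    using P[OF that(1)] that(2-4) by (simp add: P_def)
  define f where "f x = (ix x, c (ix x) x)" for x
  have "bij_betw f X (fp_carrier r M)"
    unfolding bij_betw_def
  proof (intro conjI inj_onI equalityI subsetI)
    fix x y assume xy: "x \<in> X" "y \<in> X" "f x = f y"
    have "ix x = ix y \<and> c (ix x) x = c (ix y) y" using xy(3) unfolding f_def prod.inject .
    then have eq: "ix x = ix y" "c (ix x) x = c (ix y) y" by blast+
    show "x = y"
    proof (rule inj_onD[OF bij_betw_imp_inj_on[OF c[OF ix(1)[OF xy(1)]]]])
      show "c (ix x) x = c (ix x) y" using eq(2) unfolding eq(1)[symmetric] .
    qed (use xy eq(1) in simp_all)
  next
    fix p assume "p \<in> f ` X"
    then obtain x where x: "x \<in> X" "p = f x" by blast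
    have "c (ix x) x \<in> carrier (param_group r (M (ix x)))"
      using bij_betwE[OF c[OF ix(1)[OF x(1)]]] x(1) by simp
    then show "p \<in> fp_carrier r M"
      using x ix(1)[OF x(1)] by (auto simp: f_def fp_carrier_def fp_component_def)
  next
    fix p assume "p \<in> fp_carrier r M"
    then obtain i A where p: "p = (i, A)" "i \<in> {1..r}" "A \<in> carrier (param_group r (M i))"
      by (auto simp: fp_carrier_def fp_component_def)
    then obtain x where "x \<in> X" "ix x = i" "A = c i x"
      using bij_betw_imp_surj_on[OF c[OF p(2)]] by blast
    then show "p \<in> f ` X" using p(1) by (auto simp: f_def)
  qed
  moreover have "f (tri a b) = fp_op r M (f a) (f b)" if ab: "a \<in> X" "b \<in> X" for a b
  proof -
    define i k where "i = ix a" and "k = nat ((int (ix b) - int i) mod int r)"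
    have i: "i \<in> {1..r}" using ix(1)[OF ab(1)] by (simp add: i_def)
    interpret G: comm_group "param_group r (M i)" by (rule comm_group_param_group)
    have kb: "cyc_index r i k = ix b" unfolding k_def by (rule cyc_index_of_diff[OF i ix(1)[OF ab(2)]])
    have kr: "k < r" using i by (simp add: k_def nat_less_iff)
    have "c i (tri a b) = c i a \<otimes>\<^bsub>param_group r (M i)\<^esub> param_gen r (M i) k"
    proof (cases "k = 0")
      \<comment> \<open>\<open>cT\<close> starts at \<open>k = 1\<close>; here
        \<open>x_0 = 1\<close> matches the trivial action of an orbit on itself.\<close>
      case True
      then have "ix b = i" using kb i by (simp add: cyc_index_def)
      then have "tri a b = a" using tri_same ab by (simp add: i_def)
      moreover have "c i a \<in> carrier (param_group r (M i))"
        using bij_betwE[OF c[OF i]] ab(1) by (simp add: i_def)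
      ultimately show ?thesis using True by (simp add: param_gen_def)
    next
      case False
      then show ?thesis using cT[OF i, of k a] kr ab tri_e kb by (simp add: i_def)
    qed
    moreover have "ix (tri a b) = i" using ix_tri ab by (simp add: i_def)
    ultimately show ?thesis by (simp add: f_def fp_op_def i_def k_def)
  qed
  ultimately have "quandle_iso f X tri (fp_carrier r M) (fp_op r M)" by (simp add: quandle_iso_def)
  moreover have "fp_parameters r M" using M \<open>r \<ge> 2\<close> by (simp add: fp_parameters_def)
  ultimately show ?thesis unfolding is_filtered_permutation_quandle_def by blast
qed

text \<open>The bound on \<open>card X\<close> sets aside the empty and the one-point quandle: both
  satisfy the first two conditions, while \<open>r\<close> nonempty components with
  \<open>r \<ge> 2\<close> have at least two elements.\<close>

theorem theorem2p3:
  shows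
    "(\<forall>(X :: 'a set) tri. finite X \<and> quandle X tri \<longrightarrow>
        (abelian_quandle X tri \<longleftrightarrow> two_reductive_quandle X tri) \<and>
        (2 \<le> card X \<longrightarrow>
           (two_reductive_quandle X tri \<longleftrightarrow> is_filtered_permutation_quandle X tri))) \<and>
     (\<forall>r M M'. fp_parameters r M \<and> fp_parameters r M' \<longrightarrow>
        ((\<exists>f. orbit_order_iso r M M' f) \<longleftrightarrow>
         (\<forall>i\<in>{1..r}. same_parameters r (M i) (M' i))))"
proof (intro conjI allI impI)
  fix X :: "'a set" and tri assume X: "finite X \<and> quandle X tri"
  interpret quandle X tri using X by simp
  show "abelian_quandle X tri \<longleftrightarrow> two_reductive_quandle X tri"
    by (rule abelian_iff_two_reductive)
  show "two_reductive_quandle X tri \<longleftrightarrow> is_filtered_permutation_quandle X tri" if "2 \<le> card X"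
    using that X two_reductive_imp_filtered_permutation filtered_permutation_imp_two_reductive by blast
next
  fix r M M' assume *: "fp_parameters r M \<and> fp_parameters r M'"
  show "(\<exists>f. orbit_order_iso r M M' f) \<longleftrightarrow> (\<forall>i\<in>{1..r}. same_parameters r (M i) (M' i))"
  proof
    assume "\<exists>f. orbit_order_iso r M M' f"
    then show "\<forall>i\<in>{1..r}. same_parameters r (M i) (M' i)"
      using * orbit_order_iso_relation_subgroup_eq relation_subgroup_inj
      unfolding fp_parameters_def by blast
  qed (use same_parameters_orbit_order_iso in blast)
qed

end
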